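(* Let $\rho=(r_n)_n$ be an increasing sequence in $[0,1)$ with $r_n\to1$ as $n\to\infty$. For any $\Phi:\mathbb{D}\to\mathbb{D}$ holomorphic and continuous on $\overline{\mathbb{D}}$ (i.e. extending continuously to $\overline{\mathbb{D}}$), the following statements are equivalent: (1) $\mathcal{U}_A(\mathbb{D},\rho)$ is invariant under composition from the right by $\Phi$, i.e. $f\circ\Phi\in\mathcal{U}_A(\mathbb{D},\rho)$ for every $f\in\mathcal{U}_A(\mathbb{D},\rho)$; (2) $\mathcal{U}_A(\mathbb{D})$ is invariant under composition from the right by $\Phi$, i.e. $f\circ\Phi\in\mathcal{U}_A(\mathbb{D})$ for every $f\in\mathcal{U}_A(\mathbb{D})$; (3) $\Phi$ is a rotation.
   Context: $\mathbb{D}$ is the open unit disc, $\mathbb{T}=\partial\mathbb{D}$ the unit circle, and $H(\mathbb{D})$ the space of holomorphic functions on $\mathbb{D}$. For an increasing sequence $\rho=(r_n)_n$ in $[0,1)$ with $r_n\to1$, $\mathcal{U}_A(\mathbb{D},\rho)$ denotes the set of all $f\in H(\mathbb{D})$ such that: for any compact subset $K\subset\mathbb{T}$, $K\neq\mathbb{T}$, and any continuous function $\varphi:K\to\mathbb{C}$, there exists an increasing sequence $(n_k)_k$ in $\mathbb{N}$ such that $\sup_{\zeta\in K}|f(r_{n_k}\zeta)-\varphi(\zeta)|\to0$ as $k\to\infty$. The class of Abel universal functions is $\mathcal{U}_A(\mathbb{D})=\bigcup_{\rho}\mathcal{U}_A(\mathbb{D},\rho)$, the union over all such sequences $\rho$.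 A rotation is a map $z\mapsto e^{i\theta}z$ with $\theta\in[0,2\pi]$. *)

theory Defs
  imports "HOL-Complex_Analysis.Complex_Analysis"
begin

text \<open>
  Functions on the open unit disc are represented by total functions on the complex numbers;
  every notion below depends only on their values in \<open>ball 0 1\<close>.
\<close>

text \<open>
  ``Increasing'' is read strictly, for the radii as for the indices below. Weakly increasing
  radii give the same universal functions, since each value below 1 is repeated only finitely
  often.
\<close>

definition admissible_radii :: "(nat \<Rightarrow> real) \<Rightarrow> bool" where
  "admissible_radii r \<longleftrightarrow> strict_mono r \<and> range r \<subseteq> {0..<1} \<and> r \<longlonglongrightarrow> 1"

text \<open>
  Convergence to 0 of the supremum over \<open>K\<close> is expressed by \<open>uniform_limit\<close>, which also covers
  \<open>K = {}\<close>, where the real-valued supremum is unspecified.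
\<close>

definition abel_universal_wrt :: "(nat \<Rightarrow> real) \<Rightarrow> (complex \<Rightarrow> complex) set" where
  "abel_universal_wrt r =
     {f. f holomorphic_on ball 0 1 \<and>
         (\<forall>K \<phi>. compact K \<and> K \<subseteq> sphere 0 1 \<and> K \<noteq> sphere 0 1 \<and> continuous_on K \<phi> \<longrightarrow>
            (\<exists>n::nat \<Rightarrow> nat. strict_mono n \<and>
               uniform_limit K (\<lambda>k \<zeta>. f (complex_of_real (r (n k)) * \<zeta>)) \<phi> sequentially))}"

definition abel_universal :: "(complex \<Rightarrow> complex) set" where
  "abel_universal = (\<Union>r\<in>{r. admissible_radii r}. abel_universal_wrt r)"

definition invariant_under_right_comp ::
  "(complex \<Rightarrow> complex) set \<Rightarrow> (complex \<Rightarrow> complex) \<Rightarrow> bool" where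
  "invariant_under_right_comp U \<Phi> \<longleftrightarrow> (\<forall>f\<in>U. f \<circ> \<Phi> \<in> U)"

definition is_disc_rotation :: "(complex \<Rightarrow> complex) \<Rightarrow> bool" where
  "is_disc_rotation \<Phi> \<longleftrightarrow>
     (\<exists>\<theta>\<in>{0..2 * pi}. \<forall>z\<in>ball 0 1. \<Phi> z = exp (\<i> * complex_of_real \<theta>) * z)"

end

theory Submission
  imports Defs "HOL-Computational_Algebra.Fundamental_Theorem_Algebra"
begin

text \<open>
  Only the implication from invariance to rotation is hard. Let \<open>F\<close> be the continuous extension
  of \<open>\<Phi>\<close> and suppose that \<open>f \<circ> F\<close> is Abel universal, for some radii, whenever \<open>f\<close> is universal
  along \<open>r\<close>. If \<open>norm (F \<zeta>) < 1\<close> for some \<open>\<zeta>\<close> on the circle, then \<open>f \<circ> F\<close> converges along the radius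
  to \<open>\<zeta>\<close> and is never universal, so \<open>F\<close> maps the circle to itself.

  If the modulus of \<open>F\<close> is constant on uncountably many points of a circle of radius \<open>s < 1\<close>, then the
  reflection identity \<open>F w * cnj (F (s\<^sup>2 / cnj w)) = \<rho>\<^sup>2\<close> on \<open>s\<^sup>2 < norm w < 1\<close> shows that \<open>F\<close> has no zero
  there and has constant modulus on the circle of radius \<open>s\<^sup>2\<close>. By iteration the only zero of \<open>F\<close> is
  the origin, so \<open>F z = c * z ^ d\<close>. For \<open>d \<ge> 2\<close> two radii have the same image under \<open>F\<close>, which
  excludes universality of \<open>f \<circ> F\<close>; so \<open>d = 1\<close>.

  In the remaining case a countability argument yields \<open>\<zeta>1\<close>, \<open>\<zeta>2\<close> on the circle such that for no \<open>s\<close>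
  both \<open>norm (F (s * \<zeta>1))\<close> and \<open>norm (F (s * \<zeta>2))\<close> lie in \<open>range r\<close>. One can then select closed pieces
  of the curves \<open>F (s * \<zeta>1)\<close> and \<open>F (s * \<zeta>2)\<close> that avoid all circles of radius \<open>r n\<close> and such that for every
  \<open>s\<close> near 1 one of the two points belongs to them. A Runge type construction gives a function that is
  universal along \<open>r\<close> but at most 1 in modulus on these pieces, and then \<open>f \<circ> F\<close> cannot approximate the
  constant 3 on \<open>{\<zeta>1, \<zeta>2}\<close>.
\<close>

section \<open>Uniform approximation by polynomials\<close>

definition poly_approximable :: "complex set \<Rightarrow> (complex \<Rightarrow> complex) \<Rightarrow> bool" where
  "poly_approximable L f \<longleftrightarrow> (\<forall>e>0. \<exists>p. \<forall>z\<in>L. norm (poly p z - f z) < e)"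

lemma poly_approximable_poly: "poly_approximable L (poly p)"
  unfolding poly_approximable_def by (metis norm_zero right_minus_eq)

lemma poly_approximable_const: "poly_approximable L (\<lambda>_. c)"
  using poly_approximable_poly[of L "[:c:]"] by (simp add: poly_approximable_def)

lemma poly_approximable_ident: "poly_approximable L (\<lambda>z. z)"
  using poly_approximable_poly[of L "[:0, 1:]"] by (simp add: poly_approximable_def)

lemma poly_approximable_cong:
  "poly_approximable L f \<Longrightarrow> (\<And>z. z \<in> L \<Longrightarrow> f z = g z) \<Longrightarrow> poly_approximable L g"
  unfolding poly_approximable_def by metis

lemma poly_approximable_uniform_closure:
  assumes "\<And>e. e > 0 \<Longrightarrow> \<exists>g. poly_approximable L g \<and> (\<forall>z\<in>L. norm (g z - f z) < e)"
  shows "poly_approximable L f"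
  unfolding poly_approximable_def
proof (intro allI impI)
  fix e :: real assume "e > 0"
  then obtain g where g: "poly_approximable L g" "\<forall>z\<in>L. norm (g z - f z) < e/2"
    using assms[of "e/2"] by auto
  then obtain p where p: "\<forall>z\<in>L. norm (poly p z - g z) < e/2"
    using \<open>e > 0\<close> unfolding poly_approximable_def by (meson half_gt_zero)
  have "norm (poly p z - f z) < e" if "z \<in> L" for z
    using norm_triangle_lt[of "poly p z - g z" "g z - f z" e] p g that by fastforce
  then show "\<exists>p. \<forall>z\<in>L. norm (poly p z - f z) < e" by blast
qed

lemma poly_approximable_add:
  assumes "poly_approximable L f" "poly_approximable L g"
  shows "poly_approximable L (\<lambda>z. f z + g z)"
  unfolding poly_approximable_def
proof (intro allI impI)
  fix e :: real assume "e > 0"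
  then obtain p q where p: "\<forall>z\<in>L. norm (poly p z - f z) < e/2"
    and q: "\<forall>z\<in>L. norm (poly q z - g z) < e/2"
    using assms unfolding poly_approximable_def by (meson half_gt_zero)
  have "norm (poly (p + q) z - (f z + g z)) < e" if "z \<in> L" for z
    using norm_triangle_lt[of "poly p z - f z" "poly q z - g z" e] p q that
    by (fastforce simp: algebra_simps)
  then show "\<exists>p. \<forall>z\<in>L. norm (poly p z - (f z + g z)) < e" by blast
qed

lemma poly_approximable_bounded:
  assumes "compact L" "poly_approximable L f"
  obtains M where "M > 0" "\<And>z. z \<in> L \<Longrightarrow> norm (f z) \<le> M"
proof -
  obtain p where p: "\<forall>z\<in>L. norm (poly p z - f z) < 1"
    using assms(2) unfolding poly_approximable_def by (meson zero_less_one)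
  have "bounded (poly p ` L)"
    by (intro compact_imp_bounded compact_continuous_image continuous_intros assms)
  then obtain B where B: "B > 0" "\<forall>z\<in>L. norm (poly p z) \<le> B"
    by (auto simp: bounded_pos)
  have "norm (f z) \<le> B + 1" if "z \<in> L" for z
    using norm_triangle_ineq3[of "poly p z" "f z"] p B that by fastforce
  with B(1) show ?thesis by (intro that[of "B + 1"]) auto
qed

lemma poly_approximable_mult:
  assumes "compact L" "poly_approximable L f" "poly_approximable L g"
  shows "poly_approximable L (\<lambda>z. f z * g z)"
  unfolding poly_approximable_def
proof (intro allI impI)
  fix e :: real assume "e > 0"
  obtain M where M: "M > 0" "\<And>z. z \<in> L \<Longrightarrow> norm (f z) \<le> M"
    using poly_approximable_bounded[OF assms(1,2)] by blast
  obtain q where q: "\<forall>z\<in>L. norm (poly q z - g z) < e / (2 * M)"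
    using assms(3) \<open>e > 0\<close> M(1) unfolding poly_approximable_def
    by (metis divide_pos_pos mult_pos_pos zero_less_numeral)
  obtain N where N: "N > 0" "\<And>z. z \<in> L \<Longrightarrow> norm (poly q z) \<le> N"
    using poly_approximable_bounded[OF assms(1) poly_approximable_poly[of L q]] by blast
  obtain p where p: "\<forall>z\<in>L. norm (poly p z - f z) < e / (2 * N)"
    using assms(2) \<open>e > 0\<close> N(1) unfolding poly_approximable_def
    by (metis divide_pos_pos mult_pos_pos zero_less_numeral)
  have "norm (poly (p * q) z - (f z * g z)) < e" if z: "z \<in> L" for z
  proof -
    have "poly (p * q) z - f z * g z = (poly p z - f z) * poly q z + f z * (poly q z - g z)"
      by (simp add: algebra_simps)
    also have "norm \<dots> \<le> norm (poly p z - f z) * norm (poly q z) + norm (f z) * norm (poly q z - g z)"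
      by (metis norm_mult norm_triangle_ineq)
    also have "\<dots> \<le> norm (poly p z - f z) * N + M * norm (poly q z - g z)"
      by (intro add_mono mult_left_mono mult_right_mono M N z) auto
    also have "\<dots> < e / (2 * N) * N + M * (e / (2 * M))"
      by (intro add_strict_mono mult_strict_right_mono mult_strict_left_mono M N)
         (use p q z in auto)
    also have "\<dots> = e" using M N by simp
    finally show ?thesis .
  qed
  then show "\<exists>p. \<forall>z\<in>L. norm (poly p z - f z * g z) < e" by blast
qed

lemma poly_approximable_power:
  assumes "compact L" "poly_approximable L f"
  shows "poly_approximable L (\<lambda>z. f z ^ n)"
  by (induction n) (auto intro: poly_approximable_const poly_approximable_mult assms)

lemma poly_approximable_sum:
  assumes "\<And>i. i \<in> I \<Longrightarrow> poly_approximable L (f i)"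
  shows "poly_approximable L (\<lambda>z. \<Sum>i\<in>I. f i z)"
  using assms
  by (induction I rule: infinite_finite_induct)
     (auto intro: poly_approximable_const poly_approximable_add)

section \<open>Pole pushing in the manner of Runge\<close>

text \<open>The partial sums of the geometric series of \<open>g\<close> converge uniformly on
  \<open>L\<close>, with error at most \<open>c ^ n / (1 - c)\<close> once \<open>c\<close> is
  nonnegative.\<close>

lemma poly_approximable_geometric:
  assumes "compact L" "poly_approximable L g" "c < 1" "\<And>z. z \<in> L \<Longrightarrow> norm (g z) \<le> c"
  shows "poly_approximable L (\<lambda>z. inverse (1 - g z))"
proof (rule poly_approximable_uniform_closure)
  fix e :: real assume "e > 0"
  \<comment> \<open>For empty \<open>L\<close> the bound \<open>c\<close> may be negative; the
    estimates by powers need a nonnegative base.\<close>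
  define c' where "c' = max c 0"
  have c': "0 \<le> c'" "c' < 1" "\<And>z. z \<in> L \<Longrightarrow> norm (g z) \<le> c'"
    using assms(3,4) by (auto simp: c'_def le_max_iff_disj)
  obtain n where n: "c' ^ n < e * (1 - c')"
    using real_arch_pow_inv[of "e * (1 - c')" c'] \<open>e > 0\<close> c' by auto
  have "norm ((\<Sum>k<n. g z ^ k) - inverse (1 - g z)) < e" if "z \<in> L" for z
  proof -
    have ge: "1 - c' \<le> norm (1 - g z)"
      using c'(3)[OF that] norm_triangle_ineq2[of 1 "g z"] by simp
    then have ne: "1 - g z \<noteq> 0" using c'(2) by auto
    have "(\<Sum>k<n. g z ^ k) - inverse (1 - g z) = - (g z ^ n / (1 - g z))"
    proof -
      have "(\<Sum>k<n. g z ^ k) = (1 - g z ^ n) / (1 - g z)"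
        using ne by (auto simp: sum_gp_strict)
      then show ?thesis by (simp add: diff_divide_distrib inverse_eq_divide)
    qed
    also have "norm \<dots> = norm (g z) ^ n / norm (1 - g z)"
      by (simp add: norm_divide norm_power)
    also have "\<dots> \<le> c' ^ n / (1 - c')"
      using c' that ge by (intro frac_le power_mono) auto
    also have "\<dots> < e" using n c' by (simp add: field_simps)
    finally show ?thesis .
  qed
  then show "\<exists>f. poly_approximable L f \<and> (\<forall>z\<in>L. norm (f z - inverse (1 - g z)) < e)"
    by (intro exI[of _ "\<lambda>z. \<Sum>k<n. g z ^ k"] conjI poly_approximable_sum
        poly_approximable_power assms) auto
qed

text \<open>With \<open>w = 1 / (z - p)\<close> one has
  \<open>1 / (z - q) = w / (1 - (q - p) * w)\<close>, and \<open>(q - p) * w\<close> has modulus at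
  most 1/2 on \<open>L\<close>, so a geometric series moves the pole from \<open>p\<close> to
  \<open>q\<close>.\<close>

lemma poly_approximable_inverse_shift:
  assumes "compact L" "poly_approximable L (\<lambda>z. inverse (z - p))" "d > 0"
    and "\<And>z. z \<in> L \<Longrightarrow> 2 * d \<le> norm (z - p)" "norm (q - p) \<le> d"
  shows "poly_approximable L (\<lambda>z. inverse (z - q))"
proof -
  define w where "w = (\<lambda>z. inverse (z - p))"
  have w: "poly_approximable L w" using assms by (simp add: w_def)
  have "norm ((q - p) * w z) \<le> 1/2" if "z \<in> L" for z
  proof -
    have "norm (z - p) > 0" using assms(3) assms(4)[OF that] by linarith
    moreover have "norm (q - p) * 2 \<le> norm (z - p)" using assms(4)[OF that] assms(5) by linarith
    ultimately show ?thesis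
      by (simp add: w_def norm_mult norm_divide flip: divide_inverse)
  qed
  then have "poly_approximable L (\<lambda>z. inverse (1 - (q - p) * w z))"
    by (intro poly_approximable_geometric[where c = "1/2"] poly_approximable_mult
        poly_approximable_const w assms) auto
  from poly_approximable_mult[OF assms(1) w this]
  show ?thesis
  proof (rule poly_approximable_cong)
    fix z assume "z \<in> L"
    then have "z \<noteq> p" "z \<noteq> q" using assms(3,5) assms(4)[of z] by auto
    then show "w z * inverse (1 - (q - p) * w z) = inverse (z - q)"
      by (simp add: w_def field_simps divide_simps)
  qed
qed

lemma poly_approximable_inverse_far:
  assumes "compact L" "\<And>z. z \<in> L \<Longrightarrow> 2 * norm z \<le> norm p" "p \<noteq> 0"
  shows "poly_approximable L (\<lambda>z. inverse (z - p))"
proof -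
  have "poly_approximable L (\<lambda>z. inverse (1 - z * inverse p))"
    by (intro poly_approximable_geometric[where c = "1/2"] poly_approximable_mult
        poly_approximable_const poly_approximable_ident assms)
       (use assms(2,3) in \<open>auto simp: norm_divide mult.commute simp flip: divide_inverse\<close>)
  from poly_approximable_mult[OF assms(1) poly_approximable_const[of L "- inverse p"] this]
  show ?thesis
  proof (rule poly_approximable_cong)
    fix z assume "z \<in> L"
    then have "z \<noteq> p" using assms(2)[of z] assms(3) by auto
    then show "- inverse p * inverse (1 - z * inverse p) = inverse (z - p)"
      using assms(3) by (simp add: field_simps divide_simps)
  qed
qed

text \<open>A pole far out is harmless, since there the reciprocal is a geometric series in
  \<open>z\<close>. From such a point of \<open>C\<close> the pole is moved to \<open>p\<close> in
  small shifts inside \<open>C\<close>; induction over the connected set replaces a chain of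
  discs.\<close>

lemma poly_approximable_inverse:
  assumes "compact L" "connected C" "C \<inter> L = {}" "\<not> bounded C" "p \<in> C"
  shows "poly_approximable L (\<lambda>z. inverse (z - p))"
proof (cases "L = {}")
  case True
  then show ?thesis by (simp add: poly_approximable_def)
next
  case False
  obtain B where B: "B > 0" "\<And>z. z \<in> L \<Longrightarrow> norm z \<le> B"
    using compact_imp_bounded[OF assms(1)] by (auto simp: bounded_pos)
  obtain a where a: "a \<in> C" "norm a > 2 * B"
    using assms(4) by (auto simp: bounded_iff not_le)
  have "poly_approximable L (\<lambda>z. inverse (z - a))"
    using a B by (intro poly_approximable_inverse_far assms) fastforce+
  then show ?thesis
  proof (rule connected_induction_simple[OF assms(2) a(1) assms(5), where P = "\<lambda>a. poly_approximable L (\<lambda>z. inverse (z - a))"])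
    fix a assume "a \<in> C"
    \<comment> \<open>Two points of \<open>ball a d\<close> are less than \<open>2 * d\<close> apart
      and at least \<open>5 * d\<close> away from \<open>L\<close>, which covers the
      \<open>4 * d\<close> that a shift by \<open>2 * d\<close> requires.\<close>
    define d where "d = infdist a L / 6"
    have "d > 0"
      unfolding d_def using assms \<open>a \<in> C\<close> False
      by (simp add: disjoint_iff infdist_pos_not_in_closed compact_imp_closed)
    have far: "6 * d \<le> norm (z - a)" if "z \<in> L" for z
      using infdist_le[OF that, of a] by (simp add: d_def dist_norm norm_minus_commute)
    have "poly_approximable L (\<lambda>z. inverse (z - y))"
      if "x \<in> ball a d" "y \<in> ball a d" "poly_approximable L (\<lambda>z. inverse (z - x))" for x y
    proof (rule poly_approximable_inverse_shift[OF assms(1) that(3), of "2 * d"])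
      show "norm (y - x) \<le> 2 * d"
        using that dist_triangle[of y x a] by (simp add: dist_norm norm_minus_commute)
      fix z assume "z \<in> L"
      then show "2 * (2 * d) \<le> norm (z - x)"
        using far[of z] that norm_triangle_ineq[of "z - x" "x - a"] \<open>d > 0\<close>
        by (simp add: dist_norm norm_minus_commute)
    qed (use \<open>d > 0\<close> in auto)
    then have "\<forall>x\<in>C \<inter> ball a d. \<forall>y\<in>C \<inter> ball a d.
        poly_approximable L (\<lambda>z. inverse (z - x)) \<longrightarrow> poly_approximable L (\<lambda>z. inverse (z - y))"
      by blast
    moreover have "openin (top_of_set C) (C \<inter> ball a d)" by (simp add: openin_open_Int)
    moreover have "a \<in> C \<inter> ball a d" using \<open>d > 0\<close> \<open>a \<in> C\<close> by simp
    ultimately show "\<exists>T. openin (top_of_set C) T \<and> a \<in> T \<and>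
      (\<forall>x\<in>T. \<forall>y\<in>T. poly_approximable L (\<lambda>z. inverse (z - x)) \<longrightarrow> poly_approximable L (\<lambda>z. inverse (z - y)))"
      by blast
  qed
qed

text \<open>Splitting off one root at a time writes the reciprocal as a product of simple poles,
  each of which lies in \<open>C\<close> and can be pushed to infinity.\<close>

lemma poly_approximable_inverse_poly:
  assumes "compact L" "connected C" "C \<inter> L = {}" "\<not> bounded C" "q \<noteq> 0"
    and "\<And>z. poly q z = 0 \<Longrightarrow> z \<in> C"
  shows "poly_approximable L (\<lambda>z. inverse (poly q z))"
  using assms(5,6)
proof (induction "degree q" arbitrary: q)
  case 0
  then obtain c where "q = [:c:]" using degree_eq_zeroE by metis
  then show ?case by (simp add: poly_approximable_const)
next
  case (Suc n)
  have "\<not> constant (poly q)" using Suc.hyps(2) by (simp add: constant_degree)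
  then obtain a where a: "poly q a = 0" using fundamental_theorem_of_algebra by blast
  then obtain q' where q': "q = [:-a, 1:] * q'" using poly_eq_0_iff_dvd by (metis dvdE)
  then have "q' \<noteq> 0" using Suc.prems(1) by auto
  then have "n = degree q'" using Suc.hyps(2) unfolding q' by (subst (asm) degree_mult_eq) auto
  then have "poly_approximable L (\<lambda>z. inverse (poly q' z))"
    using Suc.hyps(1)[of q'] Suc.prems \<open>q' \<noteq> 0\<close> by (auto simp: q')
  moreover have "poly_approximable L (\<lambda>z. inverse (z - a))"
    using assms(1-4) Suc.prems(2)[OF a] by (intro poly_approximable_inverse) auto
  ultimately have "poly_approximable L (\<lambda>z. inverse (z - a) * inverse (poly q' z))"
    using assms(1) poly_approximable_mult by blast
  then show ?case
    by (rule poly_approximable_cong) (simp add: q' left_diff_distrib flip: inverse_mult_distrib)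
qed

section \<open>Rays from the origin as escape routes for poles\<close>

definition ray :: "complex \<Rightarrow> complex set" where
  "ray w = (\<lambda>t. of_real t * w) ` {0..}"

lemma zero_in_ray: "0 \<in> ray w"
  by (auto simp: ray_def image_iff intro: bexI[of _ 0])

lemma closed_ray: assumes "norm w = 1" shows "closed (ray w)"
proof -
  \<comment> \<open>The parameter of a point on the ray of a unit vector is its modulus, so the ray
    is the solution set of an equation between continuous functions.\<close>
  have "ray w = {z. of_real (norm z) * w = z}"
  proof (intro equalityI subsetI)
    fix z assume "z \<in> {z. of_real (norm z) * w = z}"
    then show "z \<in> ray w" unfolding ray_def by (intro image_eqI[of _ _ "norm z"]) auto
  qed (use assms in \<open>auto simp: ray_def norm_mult\<close>)
  moreover have "closed {z. of_real (norm z) * w = z}"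
    by (intro closed_Collect_eq continuous_intros)
  ultimately show ?thesis by simp
qed

lemma in_ray_iff: assumes "norm w = 1" "norm z = 1" shows "z \<in> ray w \<longleftrightarrow> z = w"
  using assms by (auto simp: ray_def image_iff norm_mult)

lemma connected_ray: "connected (ray w)"
  unfolding ray_def by (intro connected_continuous_image continuous_intros) auto

lemma unbounded_ray:
  assumes "norm w = 1" shows "\<not> bounded (ray w)"
proof
  assume "bounded (ray w)"
  then obtain B where B: "B > 0" "\<forall>z\<in>ray w. norm z \<le> B" by (auto simp: bounded_pos)
  have "of_real (B + 1) * w \<in> ray w" unfolding ray_def using B(1) by (intro imageI) auto
  then show False using B assms by (fastforce simp: norm_mult)
qed

lemma ray_Int_arc_empty:
  assumes "K \<subseteq> sphere 0 1" "norm w = 1" "w \<notin> K"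
  shows "ray w \<inter> K = {}"
proof -
  have "z \<notin> ray w" if "z \<in> K" for z
  proof -
    have "norm z = 1" using assms(1) that by auto
    then show ?thesis using in_ray_iff[OF assms(2)] assms(3) that by auto
  qed
  then show ?thesis by auto
qed

text \<open>The circle will carry the poles of a rational kernel; the outer part of the ray meets it
  in \<open>R * w\<close> and joins it to infinity. The part of the ray inside the circle is left
  out, because the approximation takes place on a disc there.\<close>

lemma circle_ray_complement:
  assumes "R > 0" "norm w = 1" 
  defines "C \<equiv> sphere 0 R \<union> (ray w - ball 0 R)"
  shows "connected C" "\<not> bounded C"
proof -
  have eq: "ray w - ball 0 R = (\<lambda>t. of_real t * w) ` {R..}"
    using assms(1,2) by (auto simp: ray_def norm_mult)
  have "connected (ray w - ball 0 R)" unfolding eq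
    by (intro connected_continuous_image continuous_intros) auto
  moreover have "of_real R * w \<in> sphere 0 R \<inter> (ray w - ball 0 R)"
    using assms(1,2) by (auto simp: eq norm_mult)
  ultimately show "connected C"
    unfolding C_def by (intro connected_Un connected_sphere) auto
  show "\<not> bounded C"
  proof
    assume "bounded C"
    then obtain B where B: "B > 0" "\<forall>z\<in>C. norm z \<le> B" by (auto simp: bounded_pos)
    have "of_real (max (B + 1) R) * w \<in> C" unfolding C_def eq by auto
    with B assms(2) show False by (fastforce simp: norm_mult)
  qed
qed

text \<open>
  The rational functions \<open>z ^ N / (z ^ N - R ^ N)\<close> tend to 0 inside and to 1 outside the circle of radius
  \<open>R\<close>, and their poles lie on that circle, from where they can be pushed to infinity along the ray.
\<close>

lemma poly_approximable_disc_ray: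
  assumes "0 \<le> a" "compact S" "\<And>z. z \<in> S \<Longrightarrow> a < norm z" "norm w = 1" "S \<inter> ray w = {}" "e > 0"
  obtains p where "\<And>z. norm z \<le> a \<Longrightarrow> norm (poly p z) < e"
    "\<And>z. z \<in> S \<Longrightarrow> norm (poly p z - poly h z) < e"
proof -
  define L where "L = cball 0 a \<union> S"
  have L: "compact L" using assms(2) by (simp add: L_def compact_Un)
  \<comment> \<open>Compactness turns the strict inequality into a gap, so that a circle of radius
    \<open>R\<close> fits strictly between the disc and \<open>S\<close>.\<close>
  obtain b where b: "a < b" "\<And>z. z \<in> S \<Longrightarrow> b \<le> norm z"
  proof (cases "S = {}")
    case True then show ?thesis using that[of "a + 1"] by auto
  next
    case False
    have "continuous_on S norm" by (intro continuous_intros)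
    from continuous_attains_inf[OF assms(2) False this] assms(3) show ?thesis
      by (metis that)
  qed
  define R where "R = (a + b) / 2"
  have R: "a < R" "R < b" "R > 0" using b(1) assms(1) by (auto simp: R_def)
  define C where "C = sphere 0 R \<union> (ray w - ball 0 R)"
  have C: "connected C" "\<not> bounded C"
    using circle_ray_complement[OF R(3) assms(4)] by (auto simp: C_def)
  have CL: "C \<inter> L = {}"
    using R b(2) assms(5) by (auto simp: C_def L_def) force+
  obtain M where M: "M > 0" "\<And>z. z \<in> L \<Longrightarrow> norm (poly h z) \<le> M"
    using poly_approximable_bounded[OF L poly_approximable_poly[of L h]] by blast
  \<comment> \<open>The bound 1/2 keeps the denominators \<open>u - 1\<close> and
    \<open>1 - u\<close> below at least 1/2 in modulus. The other bound makes the error of the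
    kernel at most \<open>e / 2\<close>, leaving \<open>e / 2\<close> for the polynomial
    approximation of \<open>h * v\<close>.\<close>
  define \<delta> where "\<delta> = min (1/2) (e / (4 * M))"
  have \<delta>: "\<delta> > 0" "\<delta> \<le> 1/2" "2 * \<delta> * M \<le> e / 2"
    using assms(6) M(1) by (auto simp: \<delta>_def min_def field_simps)
  have "max (a / R) (R / b) < 1" using R assms(1) by auto
  from real_arch_pow_inv[OF \<delta>(1) this]
  obtain N where N: "(max (a / R) (R / b)) ^ N < \<delta>" by blast
  have N0: "N > 0" using N \<delta>(2) by (cases N) auto
  have Na: "(a / R) ^ N < \<delta>" and Nb: "(R / b) ^ N < \<delta>"
    using N power_mono[of "a / R" "max (a / R) (R / b)" N]
      power_mono[of "R / b" "max (a / R) (R / b)" N] R assms(1) by auto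
  define q where "q = monom 1 N - [:of_real R ^ N :: complex:]"
  have q: "poly q z = z ^ N - of_real R ^ N" for z
    by (simp add: q_def poly_monom)
  have "q \<noteq> 0"
    using q[of 0] R(3) N0 by (auto simp: zero_power)
  have roots: "z \<in> C" if "poly q z = 0" for z
  proof -
    have "norm z ^ N = R ^ N"
    proof -
      have "norm (z ^ N) = norm (of_real R ^ N :: complex)" using that by (simp add: q)
      then show ?thesis using R(3) by (simp add: norm_power)
    qed
    then have "norm z = R" using N0 R(3) power_eq_imp_eq_base[of "norm z" N R] by simp
    then show ?thesis by (simp add: C_def)
  qed
  define v where "v = (\<lambda>z. poly (monom 1 N) z * inverse (poly q z))"
  have "poly_approximable L (\<lambda>z. poly h z * v z)"
    unfolding v_def
    by (intro poly_approximable_mult L poly_approximable_poly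
        poly_approximable_inverse_poly[OF L C(1) CL C(2) \<open>q \<noteq> 0\<close> roots])
  then obtain p where p: "\<And>z. z \<in> L \<Longrightarrow> norm (poly p z - poly h z * v z) < e / 2"
    using assms(6) unfolding poly_approximable_def by (meson half_gt_zero)
  have vdisc: "norm (v z) \<le> 2 * \<delta>" if "norm z \<le> a" for z
  proof -
    define u where "u = (z / of_real R) ^ N"
    have "norm u \<le> (a / R) ^ N"
      unfolding u_def using that R by (simp add: norm_power norm_divide divide_right_mono power_mono)
    then have u: "norm u < \<delta>" using Na by simp
    have "z ^ N = u * of_real R ^ N" using R by (simp add: u_def power_divide)
    then have "v z = (of_real R ^ N * u) / (of_real R ^ N * (u - 1))"
      by (simp add: v_def poly_monom q divide_inverse algebra_simps)
    also have "\<dots> = u / (u - 1)" using R by simp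
    finally have "v z = u / (u - 1)" .
    moreover have "1 / 2 \<le> norm (u - 1)"
      using u \<delta>(2) norm_triangle_ineq2[of 1 u] by (simp add: norm_minus_commute)
    ultimately have "norm (v z) \<le> \<delta> / (1 / 2)"
      using u \<delta>(1) by (simp only: norm_divide) (rule frac_le; simp)
    then show ?thesis by simp
  qed
  have vS: "norm (v z - 1) \<le> 2 * \<delta>" if "z \<in> S" for z
  proof -
    have zb: "b \<le> norm z" using b that by auto
    have z0: "z \<noteq> 0" using zb R by auto
    define u where "u = (of_real R / z) ^ N"
    have "norm u \<le> (R / b) ^ N"
      unfolding u_def using zb R by (auto simp: norm_power norm_divide intro!: power_mono frac_le)
    then have u: "norm u < \<delta>" using Nb by simp
    have "of_real R ^ N = u * z ^ N" using z0 by (simp add: u_def power_divide)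
    then have "v z = (z ^ N * 1) / (z ^ N * (1 - u))"
      by (simp add: v_def poly_monom q divide_inverse algebra_simps)
    also have "\<dots> = 1 / (1 - u)" using z0 by (subst mult_divide_mult_cancel_left) auto
    finally have v: "v z = 1 / (1 - u)" .
    have h: "1 / 2 \<le> norm (1 - u)"
      using u \<delta>(2) norm_triangle_ineq2[of 1 u] by (simp add: norm_minus_commute)
    then have "1 - u \<noteq> 0" by auto
    then have "v z - 1 = u / (1 - u)" unfolding v by (simp add: divide_simps)
    then have "norm (v z - 1) \<le> \<delta> / (1 / 2)"
      using u h \<delta>(1) by (simp only: norm_divide) (rule frac_le; simp)
    then show ?thesis by simp
  qed
  show ?thesis
  proof (rule that[of p])
    fix z :: complex assume z: "norm z \<le> a"
    then have zL: "z \<in> L" by (simp add: L_def)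
    have "norm (poly h z * v z) \<le> M * (2 * \<delta>)"
      unfolding norm_mult by (intro mult_mono M vdisc zL z) (use M in auto)
    then show "norm (poly p z) < e"
      using p[OF zL] norm_triangle_ineq2[of "poly p z" "poly h z * v z"] \<delta>(3)
      by (simp add: mult.commute)
  next
    fix z assume z: "z \<in> S"
    then have zL: "z \<in> L" by (simp add: L_def)
    have "norm (poly h z * (v z - 1)) \<le> M * (2 * \<delta>)"
      unfolding norm_mult by (intro mult_mono M vS zL z) (use M in auto)
    moreover have "poly p z - poly h z = (poly p z - poly h z * v z) + poly h z * (v z - 1)"
      by (simp add: algebra_simps)
    then have "norm (poly p z - poly h z) \<le> norm (poly p z - poly h z * v z) + norm (poly h z * (v z - 1))"
      by (metis norm_triangle_ineq)
    moreover have "M * (2 * \<delta>) \<le> e / 2" using \<delta>(3) by (simp add: mult_ac)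
    ultimately show "norm (poly p z - poly h z) < e"
      using p[OF zL] by linarith
  qed
qed

section \<open>Approximation on proper compact subsets of the circle\<close>

text \<open>On the circle \<open>cnj z = 1 / z\<close>, and the pole at the origin escapes to
  infinity along the ray through a point of the circle outside \<open>K\<close>. Hence
  \<open>cnj\<close>, and with it the real and imaginary parts, are uniform limits of polynomials on
  \<open>K\<close>.\<close>

lemma poly_approximable_real_polynomial:
  assumes "compact K" "K \<subseteq> sphere 0 1" "K \<noteq> sphere 0 1" "real_polynomial_function g"
  shows "poly_approximable K (\<lambda>z. of_real (g z))"
proof -
  obtain w where "w \<in> sphere 0 1" and wK: "w \<notin> K" using assms(2,3) by blast
  then have w: "norm w = 1" "w \<notin> K" by auto
  have inv: "poly_approximable K inverse"
    using poly_approximable_inverse[OF assms(1) connected_ray ray_Int_arc_empty[OF assms(2) w]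
        unbounded_ray[OF w(1)] zero_in_ray] by simp
  have cnj: "poly_approximable K cnj"
  proof (rule poly_approximable_cong[OF inv])
    fix z assume "z \<in> K"
    then have "norm z = 1" using assms(2) by auto
    then show "inverse z = cnj z" by (simp add: inverse_complex_def complex_eq_iff cmod_def)
  qed
  have Re: "poly_approximable K (\<lambda>z. of_real (Re z))"
    by (rule poly_approximable_cong[OF poly_approximable_mult[OF assms(1) poly_approximable_const[of _ "1/2"]
       poly_approximable_add[OF poly_approximable_ident cnj]]]) (simp add: complex_eq_iff)
  have Im: "poly_approximable K (\<lambda>z. of_real (Im z))"
    by (rule poly_approximable_cong[OF poly_approximable_mult[OF assms(1) poly_approximable_const[of _ "- \<i> / 2"]
       poly_approximable_add[OF poly_approximable_ident
         poly_approximable_mult[OF assms(1) poly_approximable_const[of _ "-1"] cnj]]]])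
      (simp add: complex_eq_iff)
  show ?thesis using assms(4)
  proof (induction rule: real_polynomial_function.induct)
    case (linear f)
    interpret bounded_linear f by fact
    have "poly_approximable K (\<lambda>z. of_real (Re z) * of_real (f 1) + of_real (Im z) * of_real (f \<i>))"
      by (intro poly_approximable_add poly_approximable_mult poly_approximable_const Re Im assms)
    then show ?case
    proof (rule poly_approximable_cong)
      fix z
      have "z = Re z *\<^sub>R 1 + Im z *\<^sub>R \<i>" by (simp add: complex_eq_iff)
      then have "f z = Re z * f 1 + Im z * f \<i>" by (metis add scaleR real_scaleR_def)
      then show "of_real (Re z) * of_real (f 1) + of_real (Im z) * of_real (f \<i>) = of_real (f z)"
        by simp
    qed
  qed (auto intro: poly_approximable_const poly_approximable_add poly_approximable_mult assms(1))
qed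

text \<open>A special case of Mergelyan's theorem: by Stone-Weierstrass the real and imaginary parts
  of \<open>\<phi>\<close> are uniform limits of real polynomials in two variables, and these are
  approximable by complex polynomials on \<open>K\<close>.\<close>

lemma poly_approximable_arc:
  assumes "compact K" "K \<subseteq> sphere 0 1" "K \<noteq> sphere 0 1" "continuous_on K \<phi>"
  shows "poly_approximable K \<phi>"
proof (rule poly_approximable_uniform_closure)
  fix e :: real assume e: "e > 0"
  obtain g where g: "real_polynomial_function g" "\<And>z. z \<in> K \<Longrightarrow> \<bar>Re (\<phi> z) - g z\<bar> < e / 2"
    using Stone_Weierstrass_real_polynomial_function[OF assms(1), of "\<lambda>z. Re (\<phi> z)" "e / 2"] e assms(4)
    by (auto intro: continuous_intros)
  obtain h where h: "real_polynomial_function h" "\<And>z. z \<in> K \<Longrightarrow> \<bar>Im (\<phi> z) - h z\<bar> < e / 2"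
    using Stone_Weierstrass_real_polynomial_function[OF assms(1), of "\<lambda>z. Im (\<phi> z)" "e / 2"] e assms(4)
    by (auto intro: continuous_intros)
  have "norm ((of_real (g z) + \<i> * of_real (h z)) - \<phi> z) < e" if "z \<in> K" for z
    using cmod_le[of "(of_real (g z) + \<i> * of_real (h z)) - \<phi> z"] g(2)[OF that] h(2)[OF that]
    by (simp add: abs_minus_commute)
  then show "\<exists>f. poly_approximable K f \<and> (\<forall>z\<in>K. norm (f z - \<phi> z) < e)"
    by (intro exI[of _ "\<lambda>z. of_real (g z) + \<i> * of_real (h z)"] conjI poly_approximable_add
        poly_approximable_mult poly_approximable_const
        poly_approximable_real_polynomial[OF assms(1-3)] g(1) h(1) assms(1)) auto
qed

text \<open>Reduces the targets of a universal function to countably many polynomials. The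
  coefficients are perturbed one by one as in Horner's scheme; \<open>norm z \<le> 1\<close> keeps
  the error of the tail from growing.\<close>

lemma dense_coeff_poly_approx:
  fixes p :: "complex poly"
  assumes D: "\<And>X. open X \<Longrightarrow> X \<noteq> {} \<Longrightarrow> \<exists>d\<in>D. d \<in> X" and "e > 0"
  shows "\<exists>xs\<in>lists D. \<forall>z. norm z \<le> 1 \<longrightarrow> norm (poly (Poly xs) z - poly p z) < e"
  using assms(2)
proof (induction p arbitrary: e)
  case 0
  then show ?case by (intro bexI[of _ "[]"]) auto
next
  case (pCons a p)
  have "\<exists>d\<in>D. d \<in> ball a (e / 2)" using pCons.prems by (intro D) auto
  then obtain d where d: "d \<in> D" "norm (d - a) < e / 2"
    by (auto simp: dist_norm norm_minus_commute)
  obtain xs where xs: "xs \<in> lists D" "\<And>z. norm z \<le> 1 \<Longrightarrow> norm (poly (Poly xs) z - poly p z) < e / 2"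
    using pCons.IH[of "e / 2"] pCons.prems by auto
  have "norm (poly (Poly (d # xs)) z - poly (pCons a p) z) < e" if z: "norm z \<le> 1" for z
  proof -
    have "poly (Poly (d # xs)) z - poly (pCons a p) z = (d - a) + z * (poly (Poly xs) z - poly p z)"
      by (simp add: algebra_simps)
    also have "norm \<dots> \<le> norm (d - a) + norm z * norm (poly (Poly xs) z - poly p z)"
      by (metis norm_mult norm_triangle_ineq)
    also have "\<dots> \<le> norm (d - a) + norm (poly (Poly xs) z - poly p z)"
      using z by (simp add: mult_left_le_one_le)
    also have "\<dots> < e" using d(2) xs(2)[OF z] by simp
    finally show ?thesis .
  qed
  with d(1) xs(1) show ?case by (intro bexI[of _ "d # xs"]) auto
qed

section \<open>Construction of universal functions\<close>

text \<open>The function is a limit of polynomials \<open>P n\<close>. Passing from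
  \<open>P n\<close> to \<open>P (Suc n)\<close> changes little on the disc of radius
  \<open>r n\<close>, makes the values small on \<open>E n\<close> and fits \<open>h n\<close> on
  \<open>C n\<close>. Each \<open>E n\<close> lies strictly between the circles of radius
  \<open>r n\<close> and \<open>r (Suc n)\<close>, and \<open>C n\<close> on the outer one, so these
  demands can be met going outwards.\<close>

lemma holomorphic_small_and_interpolating:
  fixes r :: "nat \<Rightarrow> real" and E C :: "nat \<Rightarrow> complex set" and h :: "nat \<Rightarrow> complex poly"
  assumes r: "admissible_radii r"
    and E: "\<And>n. compact (E n)" "\<And>n z. z \<in> E n \<Longrightarrow> r n < norm z \<and> norm z < r (Suc n)"
      "\<And>n. E n \<inter> ray w0 = {}" "norm w0 = 1"
    and C: "\<And>n. compact (C n)" "\<And>n. C n \<subseteq> sphere 0 (r (Suc n))"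
      "\<And>n. C n \<inter> ray (w n) = {}" "\<And>n. norm (w n) = 1"
  obtains f where "f holomorphic_on ball 0 1"
    "\<And>n z. z \<in> E n \<Longrightarrow> norm (f z) \<le> 1 / 2 ^ n"
    "\<And>n z. z \<in> C n \<Longrightarrow> norm (f z - poly (h n) z) \<le> 1 / 2 ^ n"
proof -
  have sm: "strict_mono r" and r0: "\<And>n. 0 \<le> r n" and r1: "\<And>n. r n < 1" and lim: "r \<longlonglongrightarrow> 1"
    using r by (auto simp: admissible_radii_def image_subset_iff)
  have step: "\<exists>q. (\<forall>z. norm z \<le> r n \<longrightarrow> norm (poly q z - poly p z) < 1 / 2 ^ (n + 2)) \<and>
    (\<forall>z\<in>E n. norm (poly q z) < 1 / 2 ^ (n + 2)) \<and>
    (\<forall>z\<in>C n. norm (poly q z - poly (h n) z) < 1 / 2 ^ (n + 2))" for n p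
  proof -
    define \<epsilon> :: real where "\<epsilon> = 1 / 2 ^ (n + 3)"
    have \<epsilon>: "\<epsilon> > 0" "\<epsilon> + \<epsilon> = 1 / 2 ^ (n + 2)" by (auto simp: \<epsilon>_def power_add)
    \<comment> \<open>The first correction cancels \<open>p\<close> on \<open>E n\<close> and is
      small on the inner disc.\<close>
    obtain p1 where p1: "\<And>z. norm z \<le> r n \<Longrightarrow> norm (poly p1 z) < \<epsilon>"
        "\<And>z. z \<in> E n \<Longrightarrow> norm (poly p1 z - poly (- p) z) < \<epsilon>"
      using poly_approximable_disc_ray[OF r0[of n] E(1)[of n] _ E(4) E(3) \<epsilon>(1), of "- p"] E(2)
      by metis
    \<comment> \<open>The disc of radius \<open>b\<close> contains the inner disc and
      \<open>E n\<close> but stays inside the circle carrying \<open>C n\<close>. A second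
      correction that is small on it preserves what the first one achieved.\<close>
    obtain b where b: "r n \<le> b" "b < r (Suc n)" "\<And>z. z \<in> E n \<Longrightarrow> norm z \<le> b"
    proof (cases "E n = {}")
      case True
      then show ?thesis using that[of "r n"] sm by (auto simp: strict_mono_Suc_iff)
    next
      case False
      have "continuous_on (E n) norm" by (intro continuous_intros)
      from continuous_attains_sup[OF E(1) False this]
      obtain z where "z \<in> E n" "\<And>y. y \<in> E n \<Longrightarrow> norm y \<le> norm z" by blast
      then show ?thesis using that[of "norm z"] E(2)[of z n] by auto
    qed
    have "0 \<le> b" "\<And>z. z \<in> C n \<Longrightarrow> b < norm z" using b r0[of n] C(2)[of n] by auto
    then obtain p2 where p2: "\<And>z. norm z \<le> b \<Longrightarrow> norm (poly p2 z) < \<epsilon>"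
        "\<And>z. z \<in> C n \<Longrightarrow> norm (poly p2 z - poly (h n - p - p1) z) < \<epsilon>"
      using poly_approximable_disc_ray[OF _ C(1)[of n] _ C(4) C(3) \<epsilon>(1), of b "h n - p - p1"]
      by metis
    show ?thesis
    proof (intro exI[of _ "p + p1 + p2"] conjI allI ballI impI)
      fix z :: complex assume z: "norm z \<le> r n"
      have "norm (poly p1 z + poly p2 z) < \<epsilon> + \<epsilon>"
        using p1(1)[OF z] p2(1)[of z] z b(1) by (intro norm_add_less) auto
      then show "norm (poly (p + p1 + p2) z - poly p z) < 1 / 2 ^ (n + 2)"
        by (simp only: \<epsilon>(2)[symmetric]) (simp add: algebra_simps)
    next
      fix z assume z: "z \<in> E n"
      have "norm ((poly p1 z - poly (- p) z) + poly p2 z) < \<epsilon> + \<epsilon>"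
        using p1(2)[OF z] p2(1)[OF b(3)[OF z]] by (rule norm_add_less)
      then show "norm (poly (p + p1 + p2) z) < 1 / 2 ^ (n + 2)"
        by (simp only: \<epsilon>(2)[symmetric]) (simp add: algebra_simps)
    next
      fix z assume z: "z \<in> C n"
      have "norm (poly (p + p1 + p2) z - poly (h n) z) = norm (poly p2 z - poly (h n - p - p1) z)"
        by (simp add: algebra_simps)
      then show "norm (poly (p + p1 + p2) z - poly (h n) z) < 1 / 2 ^ (n + 2)"
        using p2(2)[OF z] \<epsilon> by linarith
    qed
  qed
  then obtain next_poly where next_poly:
    "\<And>n p z. norm z \<le> r n \<Longrightarrow> norm (poly (next_poly n p) z - poly p z) < 1 / 2 ^ (n + 2)"
    "\<And>n p z. z \<in> E n \<Longrightarrow> norm (poly (next_poly n p) z) < 1 / 2 ^ (n + 2)"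
    "\<And>n p z. z \<in> C n \<Longrightarrow> norm (poly (next_poly n p) z - poly (h n) z) < 1 / 2 ^ (n + 2)"
    by metis
  define P where "P = rec_nat 0 next_poly"
  have P: "P (Suc n) = next_poly n (P n)" for n by (simp add: P_def)
  have rmono: "r m \<le> r n" if "m \<le> n" for m n
    using sm that by (simp add: strict_mono_less_eq)
  \<comment> \<open>The right-hand side is the exact sum of the bounds
    \<open>1 / 2 ^ (i + 2)\<close> for \<open>i\<close> from \<open>m\<close> to
    \<open>m + j - 1\<close>, which lets the induction close.\<close>
  have tele: "norm (poly (P (m + j)) z - poly (P m) z) \<le> 1 / 2 ^ (m + 1) - 1 / 2 ^ (m + j + 1)"
    if "norm z \<le> r m" for m j z
  proof (induction j)
    case (Suc j)
    have "norm (poly (P (Suc (m + j))) z - poly (P (m + j)) z) < 1 / 2 ^ (m + j + 2)"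
      unfolding P using that rmono[of m "m + j"] by (intro next_poly(1)) auto
    moreover have "(1::real) / 2 ^ (m + j + 1) = 1 / 2 ^ (m + j + 2) + 1 / 2 ^ (m + Suc j + 1)"
      by (simp add: field_simps)
    ultimately show ?case
      using Suc norm_triangle_ineq[of "poly (P (Suc (m + j))) z - poly (P (m + j)) z"
          "poly (P (m + j)) z - poly (P m) z"] by simp
  qed auto
  have tail: "norm (poly (P n) z - poly (P m) z) \<le> 1 / 2 ^ (m + 1)" if "m \<le> n" "norm z \<le> r m" for m n z
  proof -
    have "norm (poly (P n) z - poly (P m) z) \<le> 1 / 2 ^ (m + 1) - 1 / 2 ^ (n + 1)"
      using tele[OF that(2), of "n - m"] that(1) by simp
    also have "\<dots> \<le> 1 / 2 ^ (m + 1)" by simp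
    finally show ?thesis .
  qed
  have in_r: "\<exists>m. norm z < r m" if "norm z < 1" for z :: complex
    using order_tendstoD(1)[OF lim that] by (auto simp: eventually_sequentially)
  have small: "\<exists>m\<ge>n. 1 / 2 ^ m < e" if e: "e > 0" for e :: real and n
  proof -
    obtain k where k: "(1 / 2) ^ k < e" using real_arch_pow_inv[OF e, of "1/2"] by auto
    have "1 / 2 ^ max n k \<le> (1 / 2 :: real) ^ k"
      unfolding power_one_over by (intro frac_le power_increasing) auto
    then show ?thesis using k by (intro exI[of _ "max n k"]) auto
  qed
  define f where "f z = lim (\<lambda>n. poly (P n) z)" for z
  have conv: "(\<lambda>n. poly (P n) z) \<longlonglongrightarrow> f z" if z: "norm z < 1" for z
  proof -
    obtain m where m: "norm z < r m" using in_r[OF z] by blast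
    have "Cauchy (\<lambda>n. poly (P n) z)"
    proof (rule metric_CauchyI)
      fix e :: real assume "e > 0"
      then obtain M where M: "M \<ge> m" "1 / 2 ^ M < e" using small by blast
      have "dist (poly (P i) z) (poly (P j) z) < e" if "i \<ge> M" "j \<ge> M" for i j
      proof -
        have zM: "norm z \<le> r M" using m rmono[OF M(1)] by simp
        have "dist (poly (P i) z) (poly (P j) z) \<le> 1 / 2 ^ (M + 1) + 1 / 2 ^ (M + 1)"
          using tail[OF that(1) zM] tail[OF that(2) zM]
          by (intro dist_triangle_le[of _ "poly (P M) z"]) (simp add: dist_norm)
        also have "\<dots> = 1 / 2 ^ M" by simp
        finally show ?thesis using M(2) by simp
      qed
      then show "\<exists>M. \<forall>i\<ge>M. \<forall>j\<ge>M. dist (poly (P i) z) (poly (P j) z) < e" by blast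
    qed
    then show ?thesis unfolding f_def by (simp add: Cauchy_convergent_iff convergent_LIMSEQ_iff)
  qed
  have ftail: "norm (f z - poly (P m) z) \<le> 1 / 2 ^ (m + 1)" if "norm z \<le> r m" for m z
  proof -
    have "(\<lambda>n. norm (poly (P n) z - poly (P m) z)) \<longlonglongrightarrow> norm (f z - poly (P m) z)"
      using that r1[of m] by (intro tendsto_intros conv) auto
    then show ?thesis
      by (rule tendsto_upperbound)
         (auto simp only: eventually_sequentially trivial_limit_sequentially intro!: exI[of _ m] tail[OF _ that])
  qed
  show ?thesis
  proof (rule that[of f])
    show "f holomorphic_on ball 0 1"
    proof (rule holomorphic_uniform_sequence[where f = "\<lambda>n. poly (P n)"])
      fix x :: complex assume "x \<in> ball 0 1"
      then obtain m where m: "norm x < r m" using in_r by auto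
      define d where "d = r m - norm x"
      have le: "norm z \<le> r m" if "z \<in> cball x d" for z
        using that norm_triangle_sub[of z x] by (simp add: d_def dist_norm norm_minus_commute)
      have "uniform_limit (cball x d) (\<lambda>n. poly (P n)) f sequentially"
      proof (rule uniform_limitI)
        fix e :: real assume "e > 0"
        then obtain M where M: "M \<ge> m" "1 / 2 ^ M < e" using small by blast
        show "\<forall>\<^sub>F n in sequentially. \<forall>z\<in>cball x d. dist (poly (P n) z) (f z) < e"
          unfolding eventually_sequentially
        proof (intro exI[of _ M] allI impI ballI)
          fix n z assume nz: "M \<le> n" "z \<in> cball x d"
          have "norm z \<le> r n" using le[OF nz(2)] rmono[of m n] M(1) nz(1) by simp
          then have "norm (f z - poly (P n) z) \<le> 1 / 2 ^ (n + 1)" by (rule ftail)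
          also have "\<dots> \<le> 1 / 2 ^ M" using nz(1) by (intro frac_le power_increasing) auto
          finally show "dist (poly (P n) z) (f z) < e"
            using M(2) by (simp add: dist_norm norm_minus_commute)
        qed
      qed
      moreover have "cball x d \<subseteq> ball 0 1" using le r1[of m] by fastforce
      moreover have "d > 0" using m by (simp add: d_def)
      ultimately show "\<exists>d>0. cball x d \<subseteq> ball 0 1 \<and> uniform_limit (cball x d) (\<lambda>n. poly (P n)) f sequentially"
        by blast
    qed (auto intro!: holomorphic_intros)
  next
    fix n z assume z: "z \<in> E n"
    \<comment> \<open>\<open>P (Suc n)\<close> is the first polynomial adapted to
      \<open>E n\<close>, and \<open>E n\<close> lies in the disc of radius
      \<open>r (Suc n)\<close>, where all later corrections are controlled.\<close>
    have "norm (f z - poly (P (Suc n)) z) \<le> 1 / 2 ^ (Suc n + 1)" using E(2)[OF z] by (intro ftail) auto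
    moreover have "norm (poly (P (Suc n)) z) \<le> 1 / 2 ^ (n + 2)" using next_poly(2)[OF z] P by (metis less_imp_le)
    moreover have "(1::real) / 2 ^ (Suc n + 1) + 1 / 2 ^ (n + 2) \<le> 1 / 2 ^ n" by (simp add: field_simps)
    ultimately show "norm (f z) \<le> 1 / 2 ^ n"
      using norm_triangle_ineq[of "f z - poly (P (Suc n)) z" "poly (P (Suc n)) z"] by simp
  next
    fix n z assume z: "z \<in> C n"
    have "norm (f z - poly (P (Suc n)) z) \<le> 1 / 2 ^ (Suc n + 1)" using C(2)[of n] z by (intro ftail) auto
    moreover have "norm (poly (P (Suc n)) z - poly (h n) z) \<le> 1 / 2 ^ (n + 2)"
      using next_poly(3)[OF z] P by (metis less_imp_le)
    moreover have "(1::real) / 2 ^ (Suc n + 1) + 1 / 2 ^ (n + 2) \<le> 1 / 2 ^ n" by (simp add: field_simps)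
    ultimately show "norm (f z - poly (h n) z) \<le> 1 / 2 ^ n"
      using norm_triangle_ineq[of "f z - poly (P (Suc n)) z" "poly (P (Suc n)) z - poly (h n) z"] by simp
  qed
qed

section \<open>Existence of universal functions with prescribed smallness\<close>

text \<open>Replaces the subsequence by arbitrarily late indices with error below \<open>e\<close>.
  Conversely, choosing increasing indices with errors below \<open>1 / (k + 1)\<close> recovers the
  subsequence.\<close>

lemma abel_universal_wrt_iff:
  "f \<in> abel_universal_wrt r \<longleftrightarrow> f holomorphic_on ball 0 1 \<and>
    (\<forall>K \<phi> e N. compact K \<and> K \<subseteq> sphere 0 1 \<and> K \<noteq> sphere 0 1 \<and> continuous_on K \<phi> \<and> e > 0 \<longrightarrow>
      (\<exists>n\<ge>N. \<forall>\<zeta>\<in>K. norm (f (of_real (r n) * \<zeta>) - \<phi> \<zeta>) < e))"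
  (is "_ \<longleftrightarrow> _ \<and> ?R")
proof (intro iffI conjI allI impI)
  assume f: "f \<in> abel_universal_wrt r"
  then show "f holomorphic_on ball 0 1" by (simp add: abel_universal_wrt_def)
  fix K :: "complex set" and \<phi> :: "complex \<Rightarrow> complex" and e :: real and N
  assume K: "compact K \<and> K \<subseteq> sphere 0 1 \<and> K \<noteq> sphere 0 1 \<and> continuous_on K \<phi> \<and> e > 0"
  then obtain n where n: "strict_mono n"
    "uniform_limit K (\<lambda>k \<zeta>. f (complex_of_real (r (n k)) * \<zeta>)) \<phi> sequentially"
    using f unfolding abel_universal_wrt_def by blast
  have "\<forall>\<^sub>F k in sequentially. k \<ge> N \<and> (\<forall>\<zeta>\<in>K. dist (f (complex_of_real (r (n k)) * \<zeta>)) (\<phi> \<zeta>) < e)"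
    using uniform_limitD[OF n(2), of e] K by (intro eventually_conj eventually_ge_at_top) auto
  then obtain k where "k \<ge> N" "\<forall>\<zeta>\<in>K. dist (f (complex_of_real (r (n k)) * \<zeta>)) (\<phi> \<zeta>) < e"
    using eventually_happens'[OF sequentially_bot] by blast
  then show "\<exists>n\<ge>N. \<forall>\<zeta>\<in>K. norm (f (of_real (r n) * \<zeta>) - \<phi> \<zeta>) < e"
    using seq_suble[OF n(1), of k] by (intro exI[of _ "n k"]) (auto simp: dist_norm)
next
  assume "f holomorphic_on ball 0 1 \<and> ?R"
  then have hol: "f holomorphic_on ball 0 1" and R: ?R by blast+
  have "\<exists>n::nat \<Rightarrow> nat. strict_mono n \<and>
      uniform_limit K (\<lambda>k \<zeta>. f (complex_of_real (r (n k)) * \<zeta>)) \<phi> sequentially"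
    if K: "compact K" "K \<subseteq> sphere 0 1" "K \<noteq> sphere 0 1" "continuous_on K \<phi>" for K :: "complex set" and \<phi> :: "complex \<Rightarrow> complex"
  proof -
    define A where "A k n \<longleftrightarrow> (\<forall>\<zeta>\<in>K. norm (f (of_real (r n) * \<zeta>) - \<phi> \<zeta>) < 1 / real (Suc k))" for k n
    have A: "\<exists>n\<ge>N. A k n" for k N
      unfolding A_def using R K by (metis of_nat_0_less_iff zero_less_Suc zero_less_divide_1_iff)
    have "\<exists>n. \<forall>k. A k (n k) \<and> n k < n (Suc k)"
      using A by (intro dependent_nat_choice) (metis Suc_le_lessD)+
    then obtain n where n: "\<And>k. A k (n k)" "\<And>k. n k < n (Suc k)" by blast
    have "uniform_limit K (\<lambda>k \<zeta>. f (complex_of_real (r (n k)) * \<zeta>)) \<phi> sequentially"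
    proof (rule uniform_limitI)
      fix e :: real assume "e > 0"
      then obtain M where M: "1 / real (Suc M) < e" using nat_approx_posE by blast
      show "\<forall>\<^sub>F k in sequentially. \<forall>\<zeta>\<in>K. dist (f (complex_of_real (r (n k)) * \<zeta>)) (\<phi> \<zeta>) < e"
        unfolding eventually_sequentially
      proof (intro exI[of _ M] allI impI ballI)
        fix k \<zeta> assume k: "M \<le> k" "\<zeta> \<in> K"
        have "dist (f (complex_of_real (r (n k)) * \<zeta>)) (\<phi> \<zeta>) < 1 / real (Suc k)"
          using n(1)[of k] k(2) by (auto simp: A_def dist_norm)
        also have "\<dots> \<le> 1 / real (Suc M)" using k(1) by (intro frac_le) auto
        finally show "dist (f (complex_of_real (r (n k)) * \<zeta>)) (\<phi> \<zeta>) < e" using M by simp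
      qed
    qed
    with n(2) show ?thesis by (auto simp: strict_mono_Suc_iff)
  qed
  with hol show "f \<in> abel_universal_wrt r" unfolding abel_universal_wrt_def by blast
qed

text \<open>Countably many tasks suffice: a target polynomial with coefficients in a dense set, to
  be matched on a circle with a small arc removed around a direction from a dense set. Every proper
  compact \<open>K\<close> misses such a direction, hence also every short enough arc around
  it.\<close>

lemma abel_universal_small_exists:
  fixes r :: "nat \<Rightarrow> real" and E :: "nat \<Rightarrow> complex set"
  assumes r: "admissible_radii r"
    and E: "\<And>n. compact (E n)" "\<And>n z. z \<in> E n \<Longrightarrow> r n < norm z \<and> norm z < r (Suc n)"
      "\<And>n. E n \<inter> ray w0 = {}" "norm w0 = 1"
  obtains f where "f \<in> abel_universal_wrt r" "\<And>n z. z \<in> E n \<Longrightarrow> norm (f z) \<le> 1 / 2 ^ n"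
proof -
  obtain D :: "complex set" where D: "countable D" "\<And>X. open X \<Longrightarrow> X \<noteq> {} \<Longrightarrow> \<exists>d\<in>D. d \<in> X"
    using countable_dense_exists by metis
  have rpos: "r (Suc n) > 0" for n
  proof -
    have "0 \<le> r n" "r n < r (Suc n)"
      using r by (auto simp: admissible_radii_def image_subset_iff strict_mono_Suc_iff)
    then show ?thesis by linarith
  qed
  \<comment> \<open>The first component is the target; the second encodes by its \<open>sgn\<close>
    the direction in which the circle is cut open, which is why 0 is excluded.\<close>
  define Q where "Q = (Poly ` lists D) \<times> (D - {0})"
  have Q: "countable Q" unfolding Q_def using D(1) by (intro countable_SIGMA countable_image countable_lists) auto
  have "\<exists>d\<in>D. d \<in> - {0}" by (rule D(2)) (auto intro: exI[of _ 1])
  then have Qne: "Q \<noteq> {}" by (auto simp: Q_def)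
  \<comment> \<open>Decoding pairs makes every element of \<open>Q\<close> occur infinitely often.\<close>
  define q where "q n = from_nat_into Q (fst (prod_decode n))" for n
  have qQ: "q n \<in> Q" for n unfolding q_def by (rule from_nat_into[OF Qne])
  define w where "w n = sgn (snd (q n))" for n
  have w1: "norm (w n) = 1" for n
    using qQ[of n] by (auto simp: w_def Q_def norm_sgn)
  \<comment> \<open>Rescaled so that the value at \<open>r (Suc n) * \<zeta>\<close> is the value of
    the target at \<open>\<zeta>\<close>.\<close>
  define h where "h n = pcompose (fst (q n)) [:0, of_real (1 / r (Suc n)):]" for n
  \<comment> \<open>The arc removed around \<open>w n\<close> shrinks with \<open>n\<close>, so a
    fixed \<open>K\<close> that misses the direction is eventually covered after rescaling.\<close>
  define C where "C n = sphere 0 (r (Suc n)) \<inter> {z. 1 / real (Suc n) \<le> norm (z / of_real (r (Suc n)) - w n)}" for n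
  have C1: "compact (C n)" for n
    unfolding C_def using rpos[of n]
    by (intro compact_Int_closed compact_sphere closed_Collect_le continuous_intros) auto
  have C2: "C n \<subseteq> sphere 0 (r (Suc n))" for n by (auto simp: C_def)
  have C3: "C n \<inter> ray (w n) = {}" for n
    using rpos[of n] w1[of n] by (auto simp: C_def ray_def norm_mult)
  obtain f where f: "f holomorphic_on ball 0 1"
    "\<And>n z. z \<in> E n \<Longrightarrow> norm (f z) \<le> 1 / 2 ^ n"
    "\<And>n z. z \<in> C n \<Longrightarrow> norm (f z - poly (h n) z) \<le> 1 / 2 ^ n"
    using holomorphic_small_and_interpolating[where h = h and E = E, OF r E(1) _ E(3,4) C1 C2 C3 w1] E(2) by blast
  have "\<exists>n\<ge>N. \<forall>\<zeta>\<in>K. norm (f (of_real (r n) * \<zeta>) - \<phi> \<zeta>) < e"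
    if K: "compact K" "K \<subseteq> sphere 0 1" "K \<noteq> sphere 0 1" "continuous_on K \<phi>" and e: "e > 0"
    for K \<phi> e N
  proof -
    obtain \<zeta>0 where "\<zeta>0 \<in> sphere 0 1" and "\<zeta>0 \<notin> K" using K(2,3) by blast
    then have \<zeta>0: "norm \<zeta>0 = 1" "\<zeta>0 \<notin> K" by auto
    \<comment> \<open>The nonzero points whose direction avoids \<open>K\<close> form a nonempty
      open set, so the dense set \<open>D\<close> contains one of them.\<close>
    have "open ((- {0}) \<inter> sgn -` (- K))"
      using K(1) by (intro continuous_open_preimage continuous_intros) (auto simp: compact_imp_closed)
    moreover have "\<zeta>0 \<in> (- {0}) \<inter> sgn -` (- K)" using \<zeta>0 by (auto simp: sgn_div_norm)
    ultimately obtain d where d: "d \<in> D" "d \<noteq> 0" "sgn d \<notin> K" using D(2) by blast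
    obtain \<delta> where \<delta>: "\<delta> > 0" "\<And>\<zeta>. \<zeta> \<in> K \<Longrightarrow> \<delta> \<le> norm (\<zeta> - sgn d)"
      using separate_point_closed[OF compact_imp_closed[OF K(1)] d(3)]
      by (auto simp: dist_norm norm_minus_commute)
    obtain p where p: "\<And>\<zeta>. \<zeta> \<in> K \<Longrightarrow> norm (poly p \<zeta> - \<phi> \<zeta>) < e / 3"
      using poly_approximable_arc[OF K] e unfolding poly_approximable_def by (meson divide_pos_pos zero_less_numeral)
    obtain xs where xs: "xs \<in> lists D" "\<And>z. norm z \<le> 1 \<Longrightarrow> norm (poly (Poly xs) z - poly p z) < e / 3"
      using dense_coeff_poly_approx[OF D(2), of "e / 3" p] e by auto
    have qd: "(Poly xs, d) \<in> Q" using xs(1) d by (auto simp: Q_def)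
    obtain M where M: "(1 / 2) ^ M < e / 3" using real_arch_pow_inv[of "e / 3" "1 / 2"] e by auto
    obtain M' where M': "1 / real (Suc M') < \<delta>" using nat_approx_posE[OF \<delta>(1)] by blast
    \<comment> \<open>Since a pair code is at least its second component, this forces
      \<open>n\<close> past \<open>N\<close> and makes both the error \<open>1 / 2 ^ n\<close> and
      the removed arc small enough.\<close>
    define j where "j = max N (max M M')"
    define n where "n = prod_encode (to_nat_on Q (Poly xs, d), j)"
    have nj: "j \<le> n" unfolding n_def by (rule le_prod_encode_2)
    have qn: "q n = (Poly xs, d)" unfolding q_def n_def using Q qd by simp
    have "norm (f (of_real (r (Suc n)) * \<zeta>) - \<phi> \<zeta>) < e" if \<zeta>: "\<zeta> \<in> K" for \<zeta>
    proof -
      have n1: "norm \<zeta> = 1" using K(2) \<zeta> by auto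
      let ?z = "of_real (r (Suc n)) * \<zeta>"
      have zr: "?z / of_real (r (Suc n)) = \<zeta>" using rpos[of n] by simp
      have "1 / real (Suc n) \<le> 1 / real (Suc M')" using nj by (intro frac_le) (auto simp: j_def)
      also have "\<dots> \<le> norm (\<zeta> - w n)" using M' \<delta>(2)[OF \<zeta>] by (simp add: w_def qn)
      finally have "?z \<in> C n" unfolding C_def using rpos[of n] n1 zr by (simp add: norm_mult)
      from f(3)[OF this] have "norm (f ?z - poly (Poly xs) \<zeta>) \<le> 1 / 2 ^ n"
        using rpos[of n] by (simp add: h_def qn poly_pcompose)
      also have "\<dots> \<le> 1 / 2 ^ M" using nj by (intro frac_le power_increasing) (auto simp: j_def)
      also have "\<dots> < e / 3" using M by (simp add: power_one_over)
      finally have "norm (f ?z - poly (Poly xs) \<zeta>) < e / 3" .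
      moreover have "norm (poly (Poly xs) \<zeta> - poly p \<zeta>) < e / 3" using xs(2) n1 by auto
      ultimately have "norm ((f ?z - poly (Poly xs) \<zeta>) + (poly (Poly xs) \<zeta> - poly p \<zeta>) + (poly p \<zeta> - \<phi> \<zeta>)) < e / 3 + e / 3 + e / 3"
        using p[OF \<zeta>] by (intro norm_add_less)
      then show ?thesis by simp
    qed
    moreover have "Suc n \<ge> N" using nj by (simp add: j_def)
    ultimately show ?thesis by blast
  qed
  then have "f \<in> abel_universal_wrt r" using f(1) by (auto simp: abel_universal_wrt_iff)
  then show ?thesis using that f(2) by blast
qed

section \<open>Self-maps of the disc with unimodular boundary values\<close>

lemma uncountable_sphere:
  assumes "s > 0" shows "uncountable (sphere (0::complex) s)"
proof (rule connected_uncountable)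
  show "connected (sphere (0::complex) s)" by (rule connected_sphere) simp
  show "of_real s \<in> sphere (0::complex) s" "- of_real s \<in> sphere (0::complex) s" using assms by auto
  show "of_real s \<noteq> (- of_real s :: complex)" using assms by (simp add: complex_eq_iff)
qed

lemma open_imp_fsigma:
  fixes S :: "'a::euclidean_space set"
  assumes "open S" shows "fsigma S"
  using open_Union_compact_subsets[OF assms] fsigma_Union_compact
  by (metis image_subset_iff mem_Collect_eq)

section \<open>Reflection in circles and the zeros of the self-map\<close>

text \<open>The map taking \<open>w\<close> to \<open>s\<^sup>2 / cnj w\<close> preserves the
  annulus and fixes the circle of radius \<open>s\<close> pointwise. As two conjugations cancel, the
  product is holomorphic; it equals \<open>\<rho>\<^sup>2\<close> at uncountably many points, hence
  everywhere on the annulus.\<close>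

lemma circle_reflection:
  fixes F :: "complex \<Rightarrow> complex"
  assumes hol: "F holomorphic_on ball 0 1" and s: "0 < s" "s < 1"
    and unc: "uncountable {z \<in> sphere 0 s. norm (F z) = \<rho>}"
    and w: "s\<^sup>2 < norm w" "norm w < 1"
  shows "F w * cnj (F (of_real (s\<^sup>2) / cnj w)) = of_real (\<rho>\<^sup>2)"
proof -
  define A :: "complex set" where "A = {z. s\<^sup>2 < norm (z - 0) \<and> norm (z - 0) < 1}"
  have A: "open A" "connected A"
    unfolding A_def by (intro open_Collect_conj open_Collect_less continuous_intros connected_annulus(1); simp)+
  have nz: "z \<noteq> 0" if "z \<in> A" for z
    using that s by (auto simp: A_def)
  have cnjA: "cnj ` A = A"
    unfolding A_def by (auto simp: image_iff intro!: exI[of _ "cnj _"])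
  define H where "H w = F w * cnj (F (of_real (s\<^sup>2) / cnj w)) - of_real (\<rho>\<^sup>2)" for w
  have "(\<lambda>z. F (of_real (s\<^sup>2) / z)) holomorphic_on A"
  proof -
    have "(\<lambda>z. of_real (s\<^sup>2) / z) holomorphic_on A" using nz by (intro holomorphic_intros) auto
    moreover have "(\<lambda>z. of_real (s\<^sup>2) / z) ` A \<subseteq> ball 0 1"
      using s by (auto simp: A_def norm_divide norm_power divide_simps)
    ultimately show ?thesis
      using holomorphic_on_compose_gen[OF _ hol, of "\<lambda>z. of_real (s\<^sup>2) / z" A] by (simp add: o_def)
  qed
  then have "(cnj \<circ> (\<lambda>z. F (of_real (s\<^sup>2) / z)) \<circ> cnj) holomorphic_on A"
    using A(1) by (intro holomorphic_on_compose_cnj_cnj) (simp_all add: cnjA)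
  moreover have "F holomorphic_on A" by (rule holomorphic_on_subset[OF hol]) (auto simp: A_def)
  ultimately have H: "H holomorphic_on A"
    unfolding H_def by (auto simp: o_def intro!: holomorphic_intros)
  have sub: "{z \<in> sphere 0 s. norm (F z) = \<rho>} \<subseteq> {z \<in> A. H z = 0}"
  proof
    fix z assume z: "z \<in> {z \<in> sphere 0 s. norm (F z) = \<rho>}"
    have "s\<^sup>2 < s" using s by (simp add: power2_eq_square)
    then have "z \<in> A" using z s by (auto simp: A_def)
    moreover have "of_real (s\<^sup>2) / cnj z = z"
      using z s complex_norm_square[of z] by (auto simp: field_simps)
    ultimately show "z \<in> {z \<in> A. H z = 0}"
      using z complex_norm_square[of "F z"] by (simp add: H_def)
  qed
  have "uncountable {z \<in> A. H z = 0}" using unc sub countable_subset by blast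
  then have const: "H constant_on A"
    using holomorphic_countable_zeros[OF H A open_imp_fsigma[OF A(1)]] by blast
  have "{z \<in> A. H z = 0} \<noteq> {}" using \<open>uncountable {z \<in> A. H z = 0}\<close> by (metis countable_empty)
  then have "H w = 0" using const w unfolding constant_on_def by (auto simp: A_def)
  then show ?thesis by (simp add: H_def)
qed

lemma radial_limit:
  fixes F :: "complex \<Rightarrow> complex"
  assumes "continuous_on (cball 0 1) F" "norm \<zeta> = 1"
  shows "((\<lambda>s. F (of_real s * \<zeta>)) \<longlongrightarrow> F \<zeta>) (at_left 1)"
proof -
  have "continuous_on {0..1} (\<lambda>s. F (of_real s * \<zeta>))"
    using assms(2) by (intro continuous_on_compose2[OF assms(1)] continuous_intros)
      (auto simp: norm_mult)
  then have "((\<lambda>s. F (of_real s * \<zeta>)) \<longlongrightarrow> F (of_real 1 * \<zeta>)) (at 1 within {0..1})"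
    unfolding continuous_on_def by (elim bspec) auto
  then show ?thesis by (simp add: at_within_Icc_at_left)
qed

text \<open>Let the point in the reflection identity tend radially to the unit circle: its
  reflection tends to a point of modulus \<open>s\<^sup>2\<close>, while the other factor tends to a
  value of modulus 1.\<close>

lemma modulus_on_squared_circle:
  fixes F :: "complex \<Rightarrow> complex"
  assumes hol: "F holomorphic_on ball 0 1" and cont: "continuous_on (cball 0 1) F"
    and bd: "\<And>z. norm z = 1 \<Longrightarrow> norm (F z) = 1" and s: "0 < s" "s < 1"
    and unc: "uncountable {z \<in> sphere 0 s. norm (F z) = \<rho>}" and z: "norm z = s\<^sup>2"
  shows "norm (F z) = \<rho>\<^sup>2"
proof -
  define w where "w = z / of_real (s\<^sup>2)"
  have w: "norm w = 1" using z s by (simp add: w_def norm_divide norm_power)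
  have zw: "z = of_real (s\<^sup>2) * w" using s by (simp add: w_def)
  have s2: "s\<^sup>2 < 1" "0 < s\<^sup>2" using s by (auto simp: power_less_one_iff)
  have cw: "1 / cnj w = w"
    using w complex_norm_square[of w] by (force simp: divide_eq_eq)
  have "((\<lambda>t. F (of_real (s\<^sup>2) / (of_real t * cnj w))) \<longlongrightarrow> F z) (at_left (1::real))"
  proof -
    have "isCont F z"
      using holomorphic_on_imp_continuous_on[OF hol] z s2
      by (auto simp: continuous_on_eq_continuous_at)
    moreover have "((\<lambda>t. of_real (s\<^sup>2) / (of_real t * cnj w)) \<longlongrightarrow> of_real (s\<^sup>2) / (of_real 1 * cnj w)) (at_left (1::real))"
      using w by (intro tendsto_intros) auto
    moreover have "of_real (s\<^sup>2) / (of_real 1 * cnj w) = z"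
      unfolding zw by (subst (2) cw[symmetric]) simp
    ultimately show ?thesis by (intro isCont_tendsto_compose[of _ F]) simp_all
  qed
  then have lim: "((\<lambda>t. F (of_real t * w) * cnj (F (of_real (s\<^sup>2) / (of_real t * cnj w)))) \<longlongrightarrow> F w * cnj (F z)) (at_left 1)"
    by (intro tendsto_intros radial_limit cont w)
  have "eventually (\<lambda>t::real. t \<in> {s\<^sup>2<..<1}) (at_left 1)"
    using s2 by (intro eventually_at_leftI[of "s\<^sup>2"]) auto
  then have "eventually (\<lambda>t. F (of_real t * w) * cnj (F (of_real (s\<^sup>2) / (of_real t * cnj w))) = of_real (\<rho>\<^sup>2)) (at_left 1)"
  proof eventually_elim
    case (elim t)
    have "0 < t" using elim s2(2) unfolding greaterThanLessThan_iff by linarith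
    then have "s\<^sup>2 < norm (of_real t * w)" "norm (of_real t * w) < 1"
      using elim w by (auto simp: norm_mult)
    from circle_reflection[OF hol s unc this] show ?case by simp
  qed
  then have "F w * cnj (F z) = of_real (\<rho>\<^sup>2)"
    using tendsto_unique[OF _ lim tendsto_eventually] by auto
  then have "norm (F w * cnj (F z)) = \<rho>\<^sup>2" by (metis norm_of_real abs_power2)
  then show ?thesis using bd[OF w] by (simp add: norm_mult)
qed

text \<open>For \<open>\<rho> \<noteq> 0\<close> the reflection identity excludes zeros on its
  annulus. Constancy of the modulus passes from radius \<open>s\<close> to \<open>s\<^sup>2\<close>,
  so the argument repeats with \<open>s ^ 2 ^ k\<close>, and the annuli exhaust the punctured
  disc.\<close>

lemma nonzero_of_circle:
  fixes F :: "complex \<Rightarrow> complex"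
  assumes hol: "F holomorphic_on ball 0 1" and cont: "continuous_on (cball 0 1) F"
    and bd: "\<And>z. norm z = 1 \<Longrightarrow> norm (F z) = 1" and s: "0 < s" "s < 1"
    and unc: "uncountable {z \<in> sphere 0 s. norm (F z) = \<rho>}" and w: "norm w < 1" "w \<noteq> 0"
  shows "F w \<noteq> 0"
proof -
  \<comment> \<open>Otherwise \<open>F\<close> would vanish on the whole disc and, by continuity, at
    the boundary point 1, where its modulus is 1.\<close>
  have "\<rho> \<noteq> 0"
  proof
    assume "\<rho> = 0"
    have "{z \<in> sphere 0 s. norm (F z) = \<rho>} \<subseteq> {z \<in> ball 0 1. F z = 0}"
      using s \<open>\<rho> = 0\<close> by auto
    then have unc0: "uncountable {z \<in> ball 0 1. F z = 0}" using unc countable_subset by blast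
    then have "F constant_on ball 0 1"
      using holomorphic_countable_zeros[OF hol _ _ open_imp_fsigma] by auto
    moreover have "{z \<in> ball 0 1. F z = 0} \<noteq> {}" using unc0 by (metis countable_empty)
    ultimately have "F z = 0" if "z \<in> ball 0 1" for z using that by (auto simp: constant_on_def)
    then have "F 1 = 0"
      using continuous_constant_on_closure[of "ball 0 1" F 0 1] cont by simp
    then show False using bd[of 1] by simp
  qed
  have unc_k: "uncountable {z \<in> sphere 0 (s ^ 2 ^ k). norm (F z) = \<rho> ^ 2 ^ k}" for k
  proof (induction k)
    case 0
    then show ?case using unc by simp
  next
    case (Suc k)
    have sk: "0 < s ^ 2 ^ k" "s ^ 2 ^ k < 1" using s by (auto simp: power_less_one_iff)
    have "norm (F z) = \<rho> ^ 2 ^ Suc k" if "z \<in> sphere 0 (s ^ 2 ^ Suc k)" for z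
      using modulus_on_squared_circle[OF hol cont bd sk Suc, of z] that
      by (simp add: power_mult[symmetric] mult.commute)
    then have "{z \<in> sphere 0 (s ^ 2 ^ Suc k). norm (F z) = \<rho> ^ 2 ^ Suc k} = sphere 0 (s ^ 2 ^ Suc k)"
      by auto
    then show ?case using uncountable_sphere s by simp
  qed
  obtain k where k: "s ^ k < norm w" using real_arch_pow_inv[of "norm w" s] s w by auto
  have "(s ^ 2 ^ k)\<^sup>2 = s ^ (2 ^ k * 2)" by (simp add: power_mult)
  also have "\<dots> \<le> s ^ k"
  proof (rule power_decreasing)
    have "k < 2 ^ k" by (rule less_exp)
    then show "k \<le> 2 ^ k * 2" by linarith
  qed (use s in auto)
  finally have "(s ^ 2 ^ k)\<^sup>2 < norm w" using k by simp
  moreover have "0 < s ^ 2 ^ k" "s ^ 2 ^ k < 1" using s by (auto simp: power_less_one_iff)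
  ultimately have "F w * cnj (F (of_real ((s ^ 2 ^ k)\<^sup>2) / cnj w)) = of_real ((\<rho> ^ 2 ^ k)\<^sup>2)"
    using circle_reflection[OF hol _ _ unc_k _ w(1)] by blast
  then show ?thesis using \<open>\<rho> \<noteq> 0\<close> by auto
qed

text \<open>Dividing out the zero at the origin leaves a zero-free \<open>G\<close> of modulus 1 on
  the unit circle. The maximum principle for \<open>G\<close> and for \<open>1 / G\<close> gives
  modulus 1 throughout, so \<open>G\<close> is constant.\<close>

lemma monomial_of_zero_only_at_origin:
  fixes F :: "complex \<Rightarrow> complex"
  assumes hol: "F holomorphic_on ball 0 1" and cont: "continuous_on (cball 0 1) F"
    and bd: "\<And>z. norm z = 1 \<Longrightarrow> norm (F z) = 1" and F1: "norm (F 0) < 1"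
    and nz: "\<And>w. norm w < 1 \<Longrightarrow> w \<noteq> 0 \<Longrightarrow> F w \<noteq> 0"
  obtains c d where "norm c = 1" "d > 0" "\<And>z. norm z < 1 \<Longrightarrow> F z = c * z ^ d"
proof -
  define d where "d = nat (zorder F 0)"
  define g where "g = zor_poly F 0"
  have ne: "\<exists>w\<in>ball 0 1. F w \<noteq> 0" using nz[of "1/2"] by (intro bexI[of _ "1/2"]) auto
  have "\<exists>e>0. cball (0::complex) e \<subseteq> ball 0 1 \<and> g holomorphic_on cball 0 e \<and>
      (\<forall>w\<in>cball 0 e. F w = g w * (w - 0) ^ d \<and> g w \<noteq> 0)"
    unfolding d_def g_def
    by (rule conjunct2[OF zorder_exist_zero[OF hol open_ball connected_ball _ ne]]) simp
  then obtain e where e: "e > 0" "cball (0::complex) e \<subseteq> ball 0 1" "g holomorphic_on cball 0 e"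
     "\<And>w. w \<in> cball 0 e \<Longrightarrow> F w = g w * w ^ d \<and> g w \<noteq> 0"
    by auto
  \<comment> \<open>Near the origin \<open>g\<close> removes the singularity of the quotient; both
    formulas agree on the overlap, so the glued function is holomorphic.\<close>
  define G where "G z = (if z \<in> ball 0 e then g z else F z / z ^ d)" for z
  have "F z = G z * z ^ d \<and> G z \<noteq> 0" if "norm z < 1" for z
    using e(4)[of z] nz[OF that] e(1) by (cases "z = 0") (auto simp: G_def)
  then have G1: "F z = G z * z ^ d" "G z \<noteq> 0" if "norm z < 1" for z
    using that by blast+
  have Geq: "G z = F z / z ^ d" if "z \<noteq> 0" for z
    using e(4)[of z] that by (auto simp: G_def)
  have e1: "e \<le> 1"
  proof -
    have "of_real e \<in> cball (0::complex) e" using e(1) by simp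
    then have "of_real e \<in> ball (0::complex) 1" using e(2) by blast
    then show ?thesis using e(1) by simp
  qed
  have "G holomorphic_on (ball 0 e \<union> (ball 0 1 - {0}))"
    unfolding G_def
  proof (rule holomorphic_on_If_Un)
    show "g holomorphic_on ball 0 e" by (rule holomorphic_on_subset[OF e(3)]) auto
    show "(\<lambda>z. F z / z ^ d) holomorphic_on ball 0 1 - {0}"
      by (intro holomorphic_intros holomorphic_on_subset[OF hol]) auto
    show "g z = F z / z ^ d" if "z \<in> ball 0 e" "z \<in> ball 0 1 - {0}" for z
      using e(4)[of z] that by auto
  qed auto
  moreover have "ball 0 e \<union> (ball 0 1 - {0}) = ball (0::complex) 1" using e1 e(1) by auto
  ultimately have Ghol: "G holomorphic_on ball 0 1" by simp
  have Gcont: "continuous_on (cball 0 1) G"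
  proof -
    have "isCont G z" if "norm z < 1" for z
      using holomorphic_on_imp_continuous_on[OF Ghol] that
      by (auto simp: continuous_on_eq_continuous_at)
    moreover have "(G \<longlongrightarrow> G z) (at z within cball 0 1)" if "norm z = 1" for z
    proof -
      have "z \<noteq> 0" using that by auto
      have "((\<lambda>z. F z / z ^ d) \<longlongrightarrow> F z / z ^ d) (at z within cball 0 1)"
        using cont that \<open>z \<noteq> 0\<close> by (intro tendsto_intros) (auto simp: continuous_on_def)
      moreover have "\<forall>\<^sub>F y in at z within cball 0 1. F y / y ^ d = G y"
        unfolding eventually_at using that
        by (intro exI[of _ 1] conjI ballI impI Geq[symmetric]) (auto simp: dist_norm)
      ultimately show ?thesis unfolding Geq[OF \<open>z \<noteq> 0\<close>] by (rule Lim_transform_eventually)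
    qed
    ultimately show ?thesis
      unfolding continuous_on_def
      by (metis isCont_def dist_0_norm le_less mem_cball tendsto_within_subset top_greatest)
  qed
  have Gbd: "norm (G z) = 1" if "norm z = 1" for z
  proof -
    have "z \<noteq> 0" using that by auto
    then show ?thesis using that bd by (simp add: Geq norm_divide norm_power)
  qed
  have le: "norm (G z) \<le> 1" if "norm z < 1" for z
    by (rule maximum_modulus_frontier[of G "ball 0 1"]) (use Ghol Gcont Gbd that in auto)
  have ge: "norm (inverse (G z)) \<le> 1" if "norm z < 1" for z
  proof (rule maximum_modulus_frontier[of "\<lambda>z. inverse (G z)" "ball 0 1"])
    have "G y \<noteq> 0" if "norm y \<le> 1" for y
      using G1(2)[of y] Gbd[of y] that by (cases "norm y = 1") auto
    then show "continuous_on (closure (ball 0 1)) (\<lambda>z. inverse (G z))"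
      using Gcont by (intro continuous_intros) auto
    show "(\<lambda>z. inverse (G z)) holomorphic_on interior (ball 0 1)"
      using Ghol G1(2) by (auto intro!: holomorphic_intros)
  qed (use Gbd that in \<open>auto simp: norm_inverse\<close>)
  have eq1: "norm (G z) = 1" if "norm z < 1" for z
    using le[OF that] ge[OF that] G1(2)[OF that] 
    by (simp add: norm_inverse inverse_le_1_iff)
  have "G constant_on ball 0 1"
    by (rule maximum_modulus_principle[OF Ghol _ _ _ order_refl, of 0]) (auto simp: eq1)
  then obtain c where c: "\<And>z. norm z < 1 \<Longrightarrow> G z = c" by (auto simp: constant_on_def)
  have "norm c = 1" using eq1[of 0] c[of 0] by simp
  moreover have "d > 0"
  proof (rule ccontr)
    assume "\<not> d > 0"
    then show False using G1(1)[of 0] eq1[of 0] F1 by simp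
  qed
  ultimately show ?thesis using G1(1) c by (intro that) auto
qed

section \<open>Avoiding countably many coincidences\<close>

text \<open>For real \<open>s\<close> the squared modulus is the value at \<open>s\<close> of the
  holomorphic function \<open>F (z * \<zeta>) * cnj (F (cnj z * \<zeta>))\<close>. Uncountably many
  solutions would make the modulus equal to \<open>\<rho>\<close> on the whole radius, hence also at
  \<open>\<zeta>\<close>.\<close>

lemma countable_radial_modulus:
  fixes F :: "complex \<Rightarrow> complex"
  assumes hol: "F holomorphic_on ball 0 1" and cont: "continuous_on (cball 0 1) F"
    and \<zeta>: "norm \<zeta> = 1" "norm (F \<zeta>) \<noteq> \<rho>"
  shows "countable {s. 0 < s \<and> s < 1 \<and> norm (F (of_real s * \<zeta>)) = \<rho>}" (is "countable ?S")
proof (cases "?S = {}")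
  case True
  then show ?thesis by (metis countable_empty)
next
  case False
  define G where "G z = F (z * \<zeta>) * cnj (F (cnj z * \<zeta>)) - of_real (\<rho>\<^sup>2)" for z
  have *: "(\<lambda>z. F (z * \<zeta>)) holomorphic_on ball 0 1"
  proof -
    have "(\<lambda>z. z * \<zeta>) holomorphic_on ball 0 1" by (intro holomorphic_intros)
    moreover have "(\<lambda>z. z * \<zeta>) ` ball 0 1 \<subseteq> ball 0 1" using \<zeta>(1) by (auto simp: norm_mult)
    ultimately show ?thesis
      using holomorphic_on_compose_gen[OF _ hol, of "\<lambda>z. z * \<zeta>" "ball 0 1"] by (simp add: o_def)
  qed
  have "cnj ` ball 0 1 = ball 0 1" by (auto simp: image_iff intro!: bexI[of _ "cnj _"])
  then have "(cnj \<circ> (\<lambda>z. F (z * \<zeta>)) \<circ> cnj) holomorphic_on ball 0 1"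
    using * by (intro holomorphic_on_compose_cnj_cnj) auto
  then have G: "G holomorphic_on ball 0 1"
    unfolding G_def using * by (auto simp: o_def intro!: holomorphic_intros)
  have G_real: "G (of_real s) = of_real ((norm (F (of_real s * \<zeta>)))\<^sup>2 - \<rho>\<^sup>2)" for s
    by (simp add: G_def complex_norm_square[symmetric])
  have "\<not> G constant_on ball 0 1"
  proof
    assume "G constant_on ball 0 1"
    moreover obtain s0 where "s0 \<in> ?S" using False by blast
    then have "G (of_real s0) = 0" "of_real s0 \<in> ball (0::complex) 1" by (auto simp: G_real)
    ultimately have G0: "G z = 0" if "z \<in> ball 0 1" for z
      using that by (metis constant_on_def)
    have \<rho>0: "\<rho> \<ge> 0" using \<open>s0 \<in> ?S\<close> by auto
    have "norm (F (of_real s * \<zeta>)) = \<rho>" if "0 < s" "s < 1" for s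
    proof -
      have "(norm (F (of_real s * \<zeta>)))\<^sup>2 - \<rho>\<^sup>2 = 0"
        using G0[of "of_real s"] that by (metis G_real of_real_eq_0_iff norm_of_real abs_of_pos mem_ball_0)
      then show ?thesis using \<rho>0 by (simp add: power2_eq_iff_nonneg)
    qed
    then have "eventually (\<lambda>s. norm (F (of_real s * \<zeta>)) = \<rho>) (at_left 1)"
      by (intro eventually_at_leftI[of 0]) auto
    then have "norm (F \<zeta>) = \<rho>"
      using tendsto_unique[OF _ tendsto_norm[OF radial_limit[OF cont \<zeta>(1)]] tendsto_eventually]
      by auto
    then show False using \<zeta>(2) by simp
  qed
  from holomorphic_countable_zeros[OF G _ _ open_imp_fsigma this]
  have "countable {z \<in> ball 0 1. G z = 0}" by auto
  moreover have "of_real ` ?S \<subseteq> {z \<in> ball 0 1. G z = 0}" by (auto simp: G_real)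
  ultimately have "countable (of_real ` ?S :: complex set)" by (rule countable_subset[rotated])
  then show ?thesis by (rule countable_image_inj_on) (auto simp: inj_on_def)
qed

text \<open>Only countably many \<open>s\<close> put the first curve on one of the circles. By
  \<open>count\<close> each of them rules out countably many directions, which cannot exhaust the
  unit circle.\<close>

lemma exists_complementary_radius:
  fixes F :: "complex \<Rightarrow> complex" and r :: "nat \<Rightarrow> real"
  assumes hol: "F holomorphic_on ball 0 1" and cont: "continuous_on (cball 0 1) F"
    and \<zeta>1: "norm \<zeta>1 = 1" and r: "\<And>n. norm (F \<zeta>1) \<noteq> r n"
    and count: "\<And>s \<rho>. 0 < s \<Longrightarrow> s < 1 \<Longrightarrow> countable {z \<in> sphere 0 s. norm (F z) = \<rho>}"
  shows "\<exists>\<zeta>2. norm \<zeta>2 = 1 \<and> (\<forall>s. 0 < s \<longrightarrow> s < 1 \<longrightarrow>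
     norm (F (of_real s * \<zeta>1)) \<in> range r \<longrightarrow> norm (F (of_real s * \<zeta>2)) \<notin> range r)"
proof -
  define S1 where "S1 = (\<Union>n. {s. 0 < s \<and> s < 1 \<and> norm (F (of_real s * \<zeta>1)) = r n})"
  have S1: "countable S1"
    unfolding S1_def using countable_radial_modulus[OF hol cont \<zeta>1 r] by (intro countable_UN) auto
  define bad where "bad = (\<Union>s\<in>S1. \<Union>m. {\<zeta> \<in> sphere 0 1. norm (F (of_real s * \<zeta>)) = r m})"
  have "countable {\<zeta> \<in> sphere 0 1. norm (F (of_real s * \<zeta>)) = r m}" if "s \<in> S1" for s m
  proof -
    have s: "0 < s" "s < 1" using that by (auto simp: S1_def)
    have "(\<lambda>\<zeta>. of_real s * \<zeta>) ` {\<zeta> \<in> sphere 0 1. norm (F (of_real s * \<zeta>)) = r m}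
       \<subseteq> {z \<in> sphere 0 s. norm (F z) = r m}" using s by (auto simp: norm_mult)
    then have "countable ((\<lambda>\<zeta>. of_real s * \<zeta>) ` {\<zeta> \<in> sphere 0 1. norm (F (of_real s * \<zeta>)) = r m})"
      using count[OF s] countable_subset by blast
    then show ?thesis by (rule countable_image_inj_on) (use s in \<open>auto simp: inj_on_def\<close>)
  qed
  then have "countable bad" unfolding bad_def using S1 by (intro countable_UN) auto
  then have "sphere 0 1 - bad \<noteq> {}"
    using uncountable_sphere[of 1] by (metis Diff_eq_empty_iff countable_subset zero_less_one)
  then obtain \<zeta>2 where "\<zeta>2 \<in> sphere 0 1" "\<zeta>2 \<notin> bad" by blast
  then show ?thesis by (intro exI[of _ \<zeta>2]) (auto simp: bad_def S1_def)
qed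

section \<open>Composition with self-maps of the disc\<close>

text \<open>All sample points lie in the open disc. This permits exchanging a self-map for its
  continuous extension.\<close>

lemma abel_universal_wrt_cong:
  assumes r: "admissible_radii r" and f: "f \<in> abel_universal_wrt r"
    and eq: "\<And>z. norm z < 1 \<Longrightarrow> f z = g z"
  shows "g \<in> abel_universal_wrt r"
proof -
  have "g holomorphic_on ball 0 1"
    using f holomorphic_cong[of "ball 0 1" "ball 0 1" f g] eq by (auto simp: abel_universal_wrt_iff)
  moreover have "f (of_real (r n) * \<zeta>) = g (of_real (r n) * \<zeta>)"
    if "K \<subseteq> sphere 0 1" "\<zeta> \<in> K" for n K and \<zeta> :: complex
  proof (rule eq)
    have "norm \<zeta> = 1" using that by auto
    moreover have "0 \<le> r n" "r n < 1" using r by (auto simp: admissible_radii_def image_subset_iff)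
    ultimately show "norm (of_real (r n) * \<zeta>) < 1" by (simp add: norm_mult)
  qed
  ultimately show ?thesis using f unfolding abel_universal_wrt_iff by metis
qed

lemma abel_universal_wrt_approx:
  assumes "f \<in> abel_universal_wrt r" "compact K" "K \<subseteq> sphere 0 1" "K \<noteq> sphere 0 1"
    and "continuous_on K \<phi>" "e > 0"
  obtains n where "n \<ge> N" "\<And>\<zeta>. \<zeta> \<in> K \<Longrightarrow> norm (f (of_real (r n) * \<zeta>) - \<phi> \<zeta>) < e"
proof -
  have "\<exists>n\<ge>N. \<forall>\<zeta>\<in>K. norm (f (of_real (r n) * \<zeta>) - \<phi> \<zeta>) < e"
    using assms(1)[unfolded abel_universal_wrt_iff, THEN conjunct2, rule_format, of K \<phi> e N] assms(2-6)
    by blast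
  then show ?thesis using that by blast
qed

lemma radial_image_eventually_in_open:
  fixes F :: "complex \<Rightarrow> complex"
  assumes "continuous_on (cball 0 1) F" "norm \<zeta> = 1" "open U" "F \<zeta> \<in> U"
  obtains s0 where "0 < s0" "s0 < 1" "\<And>s. s0 \<le> s \<Longrightarrow> s < 1 \<Longrightarrow> F (of_real s * \<zeta>) \<in> U"
proof -
  have "eventually (\<lambda>s. F (of_real s * \<zeta>) \<in> U) (at_left 1)"
    using radial_limit[OF assms(1,2)] assms(3,4) by (rule topological_tendstoD)
  then obtain b where b: "b < 1" "\<And>s. b < s \<Longrightarrow> s < 1 \<Longrightarrow> F (of_real s * \<zeta>) \<in> U"
    by (auto simp: eventually_at_left_field)
  show ?thesis by (rule that[of "(1 + max b 0) / 2"]) (use b in auto)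
qed

text \<open>The form used to refute universality: finitely many directions suffice, and the unknown
  radii of \<open>g\<close> enter only through some \<open>s\<close> close to 1.\<close>

lemma abel_universal_finite_approx:
  assumes g: "g \<in> abel_universal" and K: "finite K" "K \<subseteq> sphere 0 1"
    and e: "e > 0" and s0: "s0 < 1"
  obtains s where "s0 \<le> s" "s < 1" "\<And>\<zeta>. \<zeta> \<in> K \<Longrightarrow> norm (g (of_real s * \<zeta>) - \<phi> \<zeta>) < e"
proof -
  obtain r where r: "admissible_radii r" "g \<in> abel_universal_wrt r"
    using g by (auto simp: abel_universal_def)
  have "eventually (\<lambda>n. s0 < r n) sequentially"
    using r(1) s0 by (auto simp: admissible_radii_def intro: order_tendstoD)
  then obtain N where N: "\<And>n. n \<ge> N \<Longrightarrow> s0 < r n" by (auto simp: eventually_sequentially)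
  have "K \<noteq> sphere 0 1" using K(1) uncountable_sphere[of 1] countable_finite by auto
  moreover have "compact K" "continuous_on K \<phi>"
    using K(1) by (auto intro: finite_imp_compact continuous_on_finite)
  ultimately obtain n where "n \<ge> N" "\<And>\<zeta>. \<zeta> \<in> K \<Longrightarrow> norm (g (of_real (r n) * \<zeta>) - \<phi> \<zeta>) < e"
    using abel_universal_wrt_approx[OF r(2) _ K(2) _ _ e] by blast
  then show ?thesis
    using N[of n] r(1) by (intro that[of "r n"]) (auto simp: admissible_radii_def image_subset_iff)
qed

section \<open>Self-maps that destroy universality\<close>

text \<open>Near the boundary the composition stays within 1/2 of its radial limit
  \<open>f (F \<zeta>)\<close>, so it never comes within 1/2 of that limit plus 1.\<close>

lemma not_abel_universal_of_interior_boundary_value: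
  assumes f: "f holomorphic_on ball 0 1" and cont: "continuous_on (cball 0 1) F"
    and \<zeta>: "norm \<zeta> = 1" "norm (F \<zeta>) < 1"
  shows "f \<circ> F \<notin> abel_universal"
proof
  assume U: "f \<circ> F \<in> abel_universal"
  have "open (ball 0 1 \<inter> f -` ball (f (F \<zeta>)) (1/2))"
    using holomorphic_on_imp_continuous_on[OF f] by (intro continuous_open_preimage) auto
  moreover have "F \<zeta> \<in> ball 0 1 \<inter> f -` ball (f (F \<zeta>)) (1/2)" using \<zeta> by simp
  ultimately obtain s0 where s0: "s0 < 1"
    "\<And>s. s0 \<le> s \<Longrightarrow> s < 1 \<Longrightarrow> F (of_real s * \<zeta>) \<in> ball 0 1 \<inter> f -` ball (f (F \<zeta>)) (1/2)"
    using radial_image_eventually_in_open[OF cont \<zeta>(1)] by metis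
  obtain s where s: "s0 \<le> s" "s < 1" "norm (f (F (of_real s * \<zeta>)) - (f (F \<zeta>) + 1)) < 1/2"
    using abel_universal_finite_approx[OF U, of "{\<zeta>}" "1/2" s0 "\<lambda>_. f (F \<zeta>) + 1"] \<zeta>(1) s0(1) by auto
  have "norm (f (F \<zeta>) - f (F (of_real s * \<zeta>))) < 1/2"
    using s0(2)[OF s(1,2)] by (simp add: dist_norm)
  with s(3) have "norm ((f (F \<zeta>) - f (F (of_real s * \<zeta>))) + (f (F (of_real s * \<zeta>)) - (f (F \<zeta>) + 1))) < 1/2 + 1/2"
    by (intro norm_add_less)
  then show False by simp
qed

text \<open>For the root of unity \<open>\<xi> = exp (2 * pi * i / d)\<close>, the values of
  \<open>F\<close> at \<open>s\<close> and \<open>s * \<xi>\<close> agree, so targets 0 at 1 and 2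
  at \<open>\<xi>\<close> cannot both be met with error below 1.\<close>

lemma not_abel_universal_of_monomial:
  assumes d: "d \<ge> 2" and F: "\<And>z. norm z < 1 \<Longrightarrow> F z = c * z ^ d"
  shows "f \<circ> F \<notin> abel_universal"
proof
  assume U: "f \<circ> F \<in> abel_universal"
  define \<xi> where "\<xi> = cis (2 * pi / d)"
  have "\<xi> ^ d = cis (real d * (2 * pi / real d))" unfolding \<xi>_def by (rule Complex.DeMoivre)
  then have \<xi>d: "\<xi> ^ d = 1" using d by simp
  have "\<xi> \<noteq> 1"
  proof
    assume "\<xi> = 1"
    then have "cos (2 * pi / d) = 1" by (simp add: \<xi>_def complex_eq_iff)
    moreover have "cos (2 * pi / d) < cos 0"
      using d by (intro cos_monotone_0_pi) (auto simp: field_simps)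
    ultimately show False by simp
  qed
  have "norm \<xi> = 1" by (simp add: \<xi>_def)
  obtain s where s: "0 \<le> s" "s < 1"
    "\<And>\<zeta>. \<zeta> \<in> {1, \<xi>} \<Longrightarrow> norm ((f \<circ> F) (of_real s * \<zeta>) - (if \<zeta> = 1 then 0 else 2)) < 1"
    using abel_universal_finite_approx[OF U, of "{1, \<xi>}" 1 0 "\<lambda>\<zeta>. if \<zeta> = 1 then 0 else 2"] \<open>norm \<xi> = 1\<close>
    by auto
  have "F (of_real s * \<xi>) = F (of_real s)"
    using F[of "of_real s * \<xi>"] F[of "of_real s"] s(1,2) \<open>norm \<xi> = 1\<close> \<xi>d
    by (simp add: norm_mult power_mult_distrib)
  then have "norm (f (F (of_real s)) - 2) < 1" "norm (f (F (of_real s))) < 1"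
    using s(3)[of \<xi>] s(3)[of 1] \<open>\<xi> \<noteq> 1\<close> by auto
  then show False
    using norm_triangle_ineq3[of "f (F (of_real s))" 2] by simp
qed

lemma exists_not_universal_comp:
  fixes F :: "complex \<Rightarrow> complex" and r :: "nat \<Rightarrow> real"
  assumes r: "admissible_radii r"
    and cont: "continuous_on (cball 0 1) F" and into: "\<And>z. norm z < 1 \<Longrightarrow> norm (F z) < 1"
    and \<zeta>1: "norm \<zeta>1 = 1" "norm (F \<zeta>1) = 1" and \<zeta>2: "norm \<zeta>2 = 1" "norm (F \<zeta>2) = 1"
    and avoid: "\<And>s. 0 < s \<Longrightarrow> s < 1 \<Longrightarrow>
       norm (F (of_real s * \<zeta>1)) \<in> range r \<Longrightarrow> norm (F (of_real s * \<zeta>2)) \<notin> range r"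
  shows "\<exists>f\<in>abel_universal_wrt r. f \<circ> F \<notin> abel_universal"
proof -
  have sm: "strict_mono r" and r1: "\<And>n. r n < 1" and lim: "r \<longlonglongrightarrow> 1"
    using r by (auto simp: admissible_radii_def image_subset_iff)
  have "sphere 0 1 - {F \<zeta>1, F \<zeta>2} \<noteq> {}"
    using uncountable_sphere[of 1] by (metis Diff_eq_empty_iff countable_finite countable_subset finite.simps zero_less_one)
  then obtain w0 where "w0 \<in> sphere 0 1 - {F \<zeta>1, F \<zeta>2}" by blast
  then have w0: "norm w0 = 1" "w0 \<noteq> F \<zeta>1" "w0 \<noteq> F \<zeta>2" by auto
  \<comment> \<open>Inside \<open>U\<close> the curves miss the ray reserved for the poles, and
    their modulus exceeds \<open>r 0\<close>, so it falls between two consecutive radii.\<close>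
  define U where "U = - ray w0 \<inter> {z. r 0 < norm z}"
  have U: "open U" unfolding U_def
    by (intro open_Int open_Compl closed_ray w0 open_Collect_less continuous_intros)
  have FU: "F \<zeta>1 \<in> U" "F \<zeta>2 \<in> U"
    using in_ray_iff[OF w0(1)] w0 \<zeta>1 \<zeta>2 r1[of 0] by (auto simp: U_def)
  obtain a1 where a1: "0 < a1" "a1 < 1" "\<And>s. a1 \<le> s \<Longrightarrow> s < 1 \<Longrightarrow> F (of_real s * \<zeta>1) \<in> U"
    using radial_image_eventually_in_open[OF cont \<zeta>1(1) U FU(1)] by metis
  obtain a2 where a2: "0 < a2" "a2 < 1" "\<And>s. a2 \<le> s \<Longrightarrow> s < 1 \<Longrightarrow> F (of_real s * \<zeta>2) \<in> U"
    using radial_image_eventually_in_open[OF cont \<zeta>2(1) U FU(2)] by metis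
  define s0 where "s0 = max a1 a2"
  have s0: "0 < s0" "s0 < 1" using a1 a2 by (auto simp: s0_def)
  \<comment> \<open>Adjoining the limit 1 makes the set closed, so that distance 0 means
    membership.\<close>
  define R where "R = insert 1 (range r)"
  have Rcl: "closed R" "R \<noteq> {}"
    unfolding R_def using compact_sequence_with_limit[OF lim] by (auto intro: compact_imp_closed)
  define \<delta> where "\<delta> t = infdist t R" for t
  have \<delta>0: "\<delta> t = 0 \<longleftrightarrow> t = 1 \<or> t \<in> range r" for t
    using in_closed_iff_infdist_zero[OF Rcl, of t] by (auto simp: \<delta>_def R_def)
  define M where "M \<zeta> s = norm (F (of_real s * \<zeta>))" for \<zeta> s
  \<comment> \<open>Keeping \<open>s\<close> on the curve whose modulus is farther from \<open>R\<close> makes the pieces avoid the circles: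
    distance 0 there would force both moduli into \<open>range r\<close>.\<close>
  define X where "X \<zeta> \<xi> n = {s0..1} \<inter> (\<lambda>s. (M \<zeta> s, \<delta> (M \<zeta> s) - \<delta> (M \<xi> s))) -` ({r n..r (Suc n)} \<times> {0..})"
    for \<zeta> \<xi> n
  \<comment> \<open>Collects what is known about an ordered pair of directions, so that the
    estimates are proved once and applied in both orders.\<close>
  define P where "P \<zeta> \<xi> \<longleftrightarrow> norm \<zeta> = 1 \<and> norm (F \<zeta>) = 1 \<and> norm \<xi> = 1 \<and>
      (\<forall>s. s0 \<le> s \<longrightarrow> s < 1 \<longrightarrow> F (of_real s * \<zeta>) \<in> U) \<and>
      (\<forall>s. s0 \<le> s \<longrightarrow> s < 1 \<longrightarrow> M \<zeta> s \<in> range r \<longrightarrow> M \<xi> s \<notin> range r)" for \<zeta> \<xi>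
  have P12: "P \<zeta>1 \<zeta>2" "P \<zeta>2 \<zeta>1"
  proof -
    have "0 < s" "a1 \<le> s" "a2 \<le> s" if "s0 \<le> s" for s
      using that s0(1) by (auto simp: s0_def)
    then show "P \<zeta>1 \<zeta>2" "P \<zeta>2 \<zeta>1"
      unfolding P_def M_def using \<zeta>1 \<zeta>2 a1(3) a2(3) avoid by blast+
  qed
  have Fcont: "continuous_on {s0..1} (\<lambda>s. F (of_real s * \<zeta>))" if "norm \<zeta> = 1" for \<zeta>
    using that s0 by (intro continuous_on_compose2[OF cont] continuous_intros) (auto simp: norm_mult)
  define Y where "Y \<zeta> \<xi> n = (\<lambda>s. F (of_real s * \<zeta>)) ` X \<zeta> \<xi> n" for \<zeta> \<xi> n
  have Ycompact: "compact (Y \<zeta> \<xi> n)" if "P \<zeta> \<xi>" for \<zeta> \<xi> n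
  proof -
    have "continuous_on {s0..1} (\<lambda>s. (M \<zeta> s, \<delta> (M \<zeta> s) - \<delta> (M \<xi> s)))"
      unfolding M_def \<delta>_def using that
      by (intro continuous_intros Fcont) (auto simp: P_def)
    then have "closed (X \<zeta> \<xi> n)"
      unfolding X_def by (rule continuous_closed_preimage) (auto intro: closed_Times)
    then have "compact (X \<zeta> \<xi> n)"
      unfolding compact_eq_bounded_closed
      by (auto simp: X_def intro: bounded_subset[OF bounded_closed_interval])
    moreover have "continuous_on (X \<zeta> \<xi> n) (\<lambda>s. F (of_real s * \<zeta>))"
      using that by (intro continuous_on_subset[OF Fcont]) (auto simp: P_def X_def)
    ultimately show ?thesis unfolding Y_def by (intro compact_continuous_image)
  qed
  have Yprops: "r n < norm z \<and> norm z < r (Suc n) \<and> z \<notin> ray w0" if P: "P \<zeta> \<xi>" and zY: "z \<in> Y \<zeta> \<xi> n" for \<zeta> \<xi> n z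
  proof -
    obtain s where s: "z = F (of_real s * \<zeta>)" "s \<in> X \<zeta> \<xi> n" using zY by (auto simp: Y_def)
    have zM: "norm z = M \<zeta> s" by (simp add: M_def s(1))
    have sX: "s0 \<le> s" "s \<le> 1" "r n \<le> M \<zeta> s" "M \<zeta> s \<le> r (Suc n)" "\<delta> (M \<xi> s) \<le> \<delta> (M \<zeta> s)"
      using s(2) by (auto simp: X_def)
    \<comment> \<open>The endpoint belongs to the parameter interval for the sake of compactness;
      there the modulus is 1, beyond \<open>r (Suc n)\<close>.\<close>
    have "s \<noteq> 1"
    proof
      assume "s = 1"
      then have "M \<zeta> s = 1" using P by (simp add: P_def M_def)
      then show False using sX(4) r1[of "Suc n"] by simp
    qed
    then have s1: "s < 1" using sX(2) by simp
    have "M \<zeta> s \<notin> range r"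
    proof
      assume *: "M \<zeta> s \<in> range r"
      then have "\<delta> (M \<zeta> s) = 0" by (simp add: \<delta>0)
      then have "\<delta> (M \<xi> s) = 0"
        using sX(5) infdist_nonneg[of "M \<xi> s" R] by (simp add: \<delta>_def)
      moreover have "M \<xi> s < 1"
        unfolding M_def using P s1 sX(1) s0 by (intro into) (auto simp: P_def norm_mult)
      ultimately have "M \<xi> s \<in> range r" by (auto simp: \<delta>0)
      then show False using * P sX(1) s1 by (auto simp: P_def)
    qed
    then have "M \<zeta> s \<noteq> r n" "M \<zeta> s \<noteq> r (Suc n)" by auto
    moreover have "z \<in> U" using P s1 sX(1) s(1) by (simp add: P_def)
    ultimately show ?thesis using sX zM by (auto simp: U_def)
  qed
  define E where "E n = Y \<zeta>1 \<zeta>2 n \<union> Y \<zeta>2 \<zeta>1 n" for n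
  have E1: "compact (E n)" for n unfolding E_def by (intro compact_Un Ycompact P12)
  have E2: "r n < norm z \<and> norm z < r (Suc n)" if "z \<in> E n" for n z
    using that Yprops[OF P12(1)] Yprops[OF P12(2)] unfolding E_def by blast
  have E3: "E n \<inter> ray w0 = {}" for n
    using Yprops[OF P12(1)] Yprops[OF P12(2)] unfolding E_def by blast
  obtain f where f: "f \<in> abel_universal_wrt r" "\<And>n z. z \<in> E n \<Longrightarrow> norm (f z) \<le> 1 / 2 ^ n"
    using abel_universal_small_exists[where E = E, OF r E1 _ E3 w0(1)] E2 by blast
  have small: "norm (f (F (of_real s * \<zeta>))) \<le> 1"
    if "P \<zeta> \<xi>" "\<And>n. Y \<zeta> \<xi> n \<subseteq> E n" "s0 \<le> s" "s < 1" "\<delta> (M \<xi> s) \<le> \<delta> (M \<zeta> s)" for \<zeta> \<xi> s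
  proof -
    have "F (of_real s * \<zeta>) \<in> U" using that by (simp add: P_def)
    then have M0: "r 0 < M \<zeta> s" by (simp add: U_def M_def)
    have "M \<zeta> s < 1"
      unfolding M_def using that s0 by (intro into) (auto simp: P_def norm_mult)
    then obtain k where k: "M \<zeta> s < r k" using order_tendstoD(1)[OF lim] by (auto simp: eventually_sequentially)
    \<comment> \<open>The first radius exceeding the modulus; it is not \<open>r 0\<close>, so its
      predecessor gives the lower end of the annulus.\<close>
    define m where "m = (LEAST k. M \<zeta> s < r k)"
    have m: "M \<zeta> s < r m" "\<And>j. j < m \<Longrightarrow> r j \<le> M \<zeta> s"
      unfolding m_def using k by (auto intro: LeastI dest: not_less_Least)
    then obtain n where n: "m = Suc n" using M0 by (cases m) auto
    have "s \<in> X \<zeta> \<xi> n" using m n that by (auto simp: X_def)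
    then have "F (of_real s * \<zeta>) \<in> E n" using that(2)[of n] by (auto simp: Y_def)
    then have "norm (f (F (of_real s * \<zeta>))) \<le> 1 / 2 ^ n" by (rule f(2))
    also have "\<dots> \<le> 1" by simp
    finally show ?thesis .
  qed
  have "f \<circ> F \<notin> abel_universal"
  proof
    assume "f \<circ> F \<in> abel_universal"
    then obtain s where s: "s0 \<le> s" "s < 1" "\<And>\<zeta>. \<zeta> \<in> {\<zeta>1, \<zeta>2} \<Longrightarrow> norm ((f \<circ> F) (of_real s * \<zeta>) - 3) < 1"
      using abel_universal_finite_approx[of "f \<circ> F" "{\<zeta>1, \<zeta>2}" 1 s0 "\<lambda>_. 3"] \<zeta>1(1) \<zeta>2(1) s0(2) by auto
    have big: "norm (f (F (of_real s * \<zeta>))) > 1" if "\<zeta> \<in> {\<zeta>1, \<zeta>2}" for \<zeta>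
      using s(3)[OF that] norm_triangle_ineq3[of "f (F (of_real s * \<zeta>))" 3] by simp
    show False
    proof (cases "\<delta> (M \<zeta>2 s) \<le> \<delta> (M \<zeta>1 s)")
      case True
      then show ?thesis using small[OF P12(1) _ s(1,2)] big[of \<zeta>1] by (auto simp: E_def)
    next
      case False
      then show ?thesis using small[OF P12(2) _ s(1,2)] big[of \<zeta>2] by (auto simp: E_def)
    qed
  qed
  with f(1) show ?thesis by blast
qed

text \<open>The hypothesis \<open>inv\<close> lets the radii of the composition depend on
  \<open>f\<close>. It follows from either invariance statement, so one argument serves
  both.\<close>

lemma rotation_of_universal_comp:
  fixes F :: "complex \<Rightarrow> complex" and r :: "nat \<Rightarrow> real"
  assumes r: "admissible_radii r" and hol: "F holomorphic_on ball 0 1"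
    and cont: "continuous_on (cball 0 1) F" and into: "\<And>z. norm z < 1 \<Longrightarrow> norm (F z) < 1"
    and inv: "\<And>f. f \<in> abel_universal_wrt r \<Longrightarrow> f \<circ> F \<in> abel_universal"
  shows "is_disc_rotation F"
proof -
  \<comment> \<open>Empty sets impose no smallness, so this is the bare existence of a universal
    function.\<close>
  obtain f where f: "f \<in> abel_universal_wrt r"
    by (rule abel_universal_small_exists[OF r, of "\<lambda>_. {}" 1]) simp_all
  have le1: "norm (F z) \<le> 1" if "norm z = 1" for z
  proof -
    have "F ` closure (ball 0 1) \<subseteq> cball 0 1"
      using cont into by (intro image_closure_subset) (auto simp: less_imp_le)
    moreover have "F z \<in> F ` closure (ball 0 1)" using that by (intro imageI) simp
    ultimately have "F z \<in> cball 0 1" by (rule subsetD)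
    then show ?thesis by simp
  qed
  have fhol: "f holomorphic_on ball 0 1" using f by (simp add: abel_universal_wrt_iff)
  have bd: "norm (F z) = 1" if "norm z = 1" for z
  proof (rule ccontr)
    assume "norm (F z) \<noteq> 1"
    then have "norm (F z) < 1" using le1[OF that] by simp
    then show False
      using not_abel_universal_of_interior_boundary_value[OF fhol cont that] inv[OF f] by blast
  qed
  show ?thesis
  proof (cases "\<exists>s \<rho>. 0 < s \<and> s < 1 \<and> uncountable {z \<in> sphere 0 s. norm (F z) = \<rho>}")
    case True
    then obtain s \<rho> where s: "0 < s" "s < 1" "uncountable {z \<in> sphere 0 s. norm (F z) = \<rho>}" by blast
    obtain c d where cd: "norm c = 1" "d > 0" "\<And>z. norm z < 1 \<Longrightarrow> F z = c * z ^ d"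
      using monomial_of_zero_only_at_origin[OF hol cont bd into[of 0] nonzero_of_circle[OF hol cont bd s]]
      by auto
    have "\<not> d \<ge> 2" using not_abel_universal_of_monomial[of d F c f] cd(3) inv[OF f] by blast
    then have "d = 1" using cd(2) by simp
    have "c = exp (\<i> * of_real (Arg2pi c))" using Arg2pi[of c] cd(1) by (simp add: is_Arg_def)
    then show ?thesis
      unfolding is_disc_rotation_def using cd(3) \<open>d = 1\<close> Arg2pi[of c]
      by (intro bexI[of _ "Arg2pi c"]) auto
  next
    case False
    have r1: "norm (F 1) \<noteq> r n" for n
      using bd[of 1] r by (auto simp: admissible_radii_def image_subset_iff less_le)
    have count: "countable {z \<in> sphere 0 s. norm (F z) = \<rho>}" if "0 < s" "s < 1" for s \<rho>
      using False that by blast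
    obtain \<zeta>2 where \<zeta>2: "norm \<zeta>2 = 1" "\<forall>s. 0 < s \<longrightarrow> s < 1 \<longrightarrow>
        norm (F (of_real s * 1)) \<in> range r \<longrightarrow> norm (F (of_real s * \<zeta>2)) \<notin> range r"
      using exists_complementary_radius[where r = r, OF hol cont norm_one r1 count] by blast
    have "\<exists>f\<in>abel_universal_wrt r. f \<circ> F \<notin> abel_universal"
      using \<zeta>2 by (intro exists_not_universal_comp[OF r cont into, of 1 \<zeta>2] bd) simp_all
    then show ?thesis using inv by blast
  qed
qed

text \<open>Rotations preserve every circle around the origin: approximating
  \<open>\<phi> (z / w)\<close> by \<open>f\<close> on the rotated set \<open>w * K\<close> serves
  with the same radii.\<close>

lemma abel_universal_wrt_rotation:
  assumes f: "f \<in> abel_universal_wrt r" and w: "norm w = 1"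
  shows "(\<lambda>z. f (w * z)) \<in> abel_universal_wrt r"
  unfolding abel_universal_wrt_iff
proof (intro conjI allI impI)
  have "(\<lambda>z. w * z) holomorphic_on ball 0 1" by (intro holomorphic_intros)
  moreover have "(\<lambda>z. w * z) ` ball 0 1 \<subseteq> ball 0 1" using w by (auto simp: norm_mult)
  ultimately show "(\<lambda>z. f (w * z)) holomorphic_on ball 0 1"
    using holomorphic_on_compose_gen[of "\<lambda>z. w * z" "ball 0 1" f "ball 0 1"] f
    by (simp add: o_def abel_universal_wrt_iff)
  fix K :: "complex set" and \<phi> :: "complex \<Rightarrow> complex" and e :: real and N
  assume K: "compact K \<and> K \<subseteq> sphere 0 1 \<and> K \<noteq> sphere 0 1 \<and> continuous_on K \<phi> \<and> 0 < e"
  have w0: "w \<noteq> 0" using w by auto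
  let ?K = "(\<lambda>z. w * z) ` K"
  have "compact ?K" using K by (intro compact_continuous_image continuous_intros) auto
  moreover have "?K \<subseteq> sphere 0 1" using K w by (auto simp: norm_mult)
  moreover have "?K \<noteq> sphere 0 1"
  proof -
    obtain z where z: "z \<in> sphere 0 1" "z \<notin> K" using K by blast
    then have "w * z \<in> sphere 0 1" "w * z \<notin> ?K" using w w0 by (auto simp: norm_mult)
    then show ?thesis by blast
  qed
  moreover have "continuous_on ?K (\<lambda>z. \<phi> (z / w))"
  proof -
    have "(\<lambda>z. z / w) ` ?K = K" using w0 by (simp add: image_image)
    then have "continuous_on ?K (\<phi> \<circ> (\<lambda>z. z / w))"
      using K by (intro continuous_on_compose continuous_intros) (simp_all add: w0)
    then show ?thesis by (simp add: o_def)
  qed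
  ultimately obtain n where n: "n \<ge> N"
    "\<And>\<zeta>. \<zeta> \<in> ?K \<Longrightarrow> norm (f (of_real (r n) * \<zeta>) - \<phi> (\<zeta> / w)) < e"
    using abel_universal_wrt_approx[OF f, of ?K "\<lambda>z. \<phi> (z / w)" e N] K by blast
  have "norm (f (w * (of_real (r n) * \<zeta>)) - \<phi> \<zeta>) < e" if "\<zeta> \<in> K" for \<zeta>
    using n(2)[of "w * \<zeta>"] that w0 by (simp add: mult.left_commute)
  with n(1) show "\<exists>n\<ge>N. \<forall>\<zeta>\<in>K. norm (f (w * (of_real (r n) * \<zeta>)) - \<phi> \<zeta>) < e" by blast
qed

lemma abel_universal_wrt_disc_rotation:
  assumes r: "admissible_radii r" and f: "f \<in> abel_universal_wrt r" and \<Phi>: "is_disc_rotation \<Phi>"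
  shows "f \<circ> \<Phi> \<in> abel_universal_wrt r"
proof -
  obtain \<theta> where \<theta>: "\<forall>z\<in>ball 0 1. \<Phi> z = exp (\<i> * of_real \<theta>) * z"
    using \<Phi> unfolding is_disc_rotation_def by blast
  have "(\<lambda>z. f (exp (\<i> * of_real \<theta>) * z)) \<in> abel_universal_wrt r"
    using f by (rule abel_universal_wrt_rotation) simp
  then show ?thesis by (rule abel_universal_wrt_cong[OF r]) (simp add: \<theta>)
qed

theorem corollary3p2:
  fixes r :: "nat \<Rightarrow> real" and \<Phi> :: "complex \<Rightarrow> complex"
  assumes "admissible_radii r"
    and "\<Phi> holomorphic_on ball 0 1"
    and "\<Phi> ` ball 0 1 \<subseteq> ball 0 1"
    and "\<exists>\<Psi>. continuous_on (cball 0 1) \<Psi> \<and> (\<forall>z\<in>ball 0 1. \<Psi> z = \<Phi> z)"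
  shows "(invariant_under_right_comp (abel_universal_wrt r) \<Phi> \<longleftrightarrow>
            invariant_under_right_comp abel_universal \<Phi>) \<and>
         (invariant_under_right_comp abel_universal \<Phi> \<longleftrightarrow> is_disc_rotation \<Phi>)"
proof -
  obtain \<Psi> where \<Psi>: "continuous_on (cball 0 1) \<Psi>" "\<And>z. norm z < 1 \<Longrightarrow> \<Psi> z = \<Phi> z"
    using assms(4) by auto
  have sub: "abel_universal_wrt r \<subseteq> abel_universal"
    using assms(1) by (auto simp: abel_universal_def)
  have hol: "\<Psi> holomorphic_on ball 0 1"
    using assms(2) holomorphic_cong[of "ball 0 1" "ball 0 1" \<Psi> \<Phi>] \<Psi>(2) by auto
  have into: "norm (\<Psi> z) < 1" if "norm z < 1" for z
  proof -
    have "z \<in> ball 0 1" using that by simp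
    then have "\<Phi> z \<in> ball 0 1" using assms(3) by blast
    then show ?thesis using \<Psi>(2)[OF that] by simp
  qed
  \<comment> \<open>Since \<open>abel_universal_wrt r\<close> is contained in
    \<open>abel_universal\<close>, each of the two invariance statements yields this
    premise.\<close>
  have rot: "is_disc_rotation \<Phi>"
    if inv: "\<forall>f\<in>abel_universal_wrt r. f \<circ> \<Phi> \<in> abel_universal"
  proof -
    have univ: "f \<circ> \<Psi> \<in> abel_universal" if "f \<in> abel_universal_wrt r" for f
    proof -
      obtain r' where r': "admissible_radii r'" "f \<circ> \<Phi> \<in> abel_universal_wrt r'"
        using inv \<open>f \<in> abel_universal_wrt r\<close> unfolding abel_universal_def by blast
      have "f \<circ> \<Psi> \<in> abel_universal_wrt r'"
        by (rule abel_universal_wrt_cong[OF r']) (simp add: \<Psi>(2))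
      then show ?thesis using r'(1) unfolding abel_universal_def by blast
    qed
    have "is_disc_rotation \<Psi>"
      by (rule rotation_of_universal_comp[OF assms(1) hol \<Psi>(1) into univ])
    then show ?thesis using \<Psi>(2) by (simp add: is_disc_rotation_def)
  qed
  have "invariant_under_right_comp (abel_universal_wrt r) \<Phi> \<longleftrightarrow> is_disc_rotation \<Phi>"
    using rot sub abel_universal_wrt_disc_rotation[OF assms(1)]
    unfolding invariant_under_right_comp_def by blast
  moreover have "invariant_under_right_comp abel_universal \<Phi> \<longleftrightarrow> is_disc_rotation \<Phi>"
  proof
    assume "invariant_under_right_comp abel_universal \<Phi>"
    then show "is_disc_rotation \<Phi>"
      using rot sub unfolding invariant_under_right_comp_def by blast
  next
    assume \<Phi>: "is_disc_rotation \<Phi>"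
    have "f \<circ> \<Phi> \<in> abel_universal" if "f \<in> abel_universal" for f
    proof -
      obtain r' where r': "admissible_radii r'" "f \<in> abel_universal_wrt r'"
        using \<open>f \<in> abel_universal\<close> unfolding abel_universal_def by blast
      have "f \<circ> \<Phi> \<in> abel_universal_wrt r'"
        by (rule abel_universal_wrt_disc_rotation[OF r' \<Phi>])
      then show ?thesis using r'(1) unfolding abel_universal_def by blast
    qed
    then show "invariant_under_right_comp abel_universal \<Phi>"
      unfolding invariant_under_right_comp_def by blast
  qed
  ultimately show ?thesis by blast
qed

end
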